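(* Let $2<p<\infty$ and let $Y$ be a closed subspace of $JT_{2,p}$ not containing a subspace isomorphic to $\ell_p$. Then there exist a finite set of branches $\tau_1,\dots,\tau_d$ of $\mathcal T$ and a finite codimensional subspace $Y_0$ of $Y$ such that the bounded projection $P(y)=y|_{\mathrm T}$, where $\mathrm T=\bigcup_{i\le d}\tau_i$, restricted to $Y_0$, is an isomorphism (onto its image).
   Context: $\mathbb N=\{1,2,\dots\}$. Fix a partial order $\preceq$ on $\mathbb N$, compatible with the usual order ($n\preceq m$ implies $n\le m$), defining an infinitely branching tree without root: the predecessors of each element are linearly ordered, there are infinitely many minimal elements, and every element has infinitely many immediate successors. $\mathcal T$ denotes this tree with the empty set added as a root. A segment is a set $\{k\in\mathbb N: m\preceq k\preceq n\}$ with $m\preceq n$; a branch is a maximal linearly ordered subset of $\mathbb N$. $c_{00}(\mathbb N)$ is the space of finitely supported real sequences with unit vectors $e_n$. For $2<p<\infty$, $JT_{2,p}$ is the completion of $c_{00}(\mathbb N)$ under the norm $$\|x\|=\sup\Big\{\Big(\sum_{k=1}^n\Big(\sum_{i\in s_k}x(i)^2\Big)^{p/2}\Big)^{1/p}: n\in\mathbb N,\ s_1,\dots,s_n \text{ pairwise disjoint segments}\Big\}.$$ The sequence $(e_n)_n$ is a $1$-unconditional Schauder basis of $JT_{2,p}$; for $x=\sum_n x(n)e_n$ and $A\subset\mathbb N$, $x|_A=\sum_{n\in A}x(n)e_n$. Subspaces, including $Y_0$, are closed linear subspaces. An isomorphism onto its image is a bounded linear map that is bounded below. *)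

theory Defs
  imports "HOL-Analysis.Analysis"
begin

text \<open>
  The positive integers are represented by the type \<^typ>\<open>nat\<close>, relabelled by \<open>n \<mapsto> n - 1\<close>;
  only their order matters. The partial order on them is a relation \<open>r\<close>, with \<open>(m, n) \<in> r\<close>
  meaning that \<open>m\<close> precedes or equals \<open>n\<close>. The root that is added to the tree is an element of no
  segment and of no branch, so it does not appear.
\<close>

definition immediate_successors :: "nat rel \<Rightarrow> nat \<Rightarrow> nat set" where
  "immediate_successors r m =
     {n. (m, n) \<in> r \<and> m \<noteq> n \<and> (\<forall>k. (m, k) \<in> r \<and> (k, n) \<in> r \<longrightarrow> k = m \<or> k = n)}"

definition infinitely_branching_tree :: "nat rel \<Rightarrow> bool" where
  "infinitely_branching_tree r \<longleftrightarrow>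
     partial_order_on UNIV r \<and>
     (\<forall>m n. (m, n) \<in> r \<longrightarrow> m \<le> n) \<and>
     (\<forall>n. {m. (m, n) \<in> r} \<in> Chains r) \<and>
     infinite {m. \<forall>k. (k, m) \<in> r \<longrightarrow> k = m} \<and>
     (\<forall>m. infinite (immediate_successors r m))"

definition is_segment :: "nat rel \<Rightarrow> nat set \<Rightarrow> bool" where
  "is_segment r s \<longleftrightarrow> (\<exists>m n. (m, n) \<in> r \<and> s = {k. (m, k) \<in> r \<and> (k, n) \<in> r})"

definition is_branch :: "nat rel \<Rightarrow> nat set \<Rightarrow> bool" where
  "is_branch r B \<longleftrightarrow> B \<in> Chains r \<and> (\<forall>C \<in> Chains r. B \<subseteq> C \<longrightarrow> C = B)"

definition c00 :: "(nat \<Rightarrow> real) set" where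
  "c00 = {x. finite {n. x n \<noteq> 0}}"

definition unit_seq :: "nat \<Rightarrow> nat \<Rightarrow> real" where
  "unit_seq n = (\<lambda>k. if k = n then 1 else 0)"

definition jt_norm :: "nat rel \<Rightarrow> real \<Rightarrow> (nat \<Rightarrow> real) \<Rightarrow> real" where
  "jt_norm r p x =
     Sup {(\<Sum>k=1..n. (\<Sum>i\<in>s k. (x i)\<^sup>2) powr (p / 2)) powr (1 / p) |n (s :: nat \<Rightarrow> nat set).
            1 \<le> n \<and> (\<forall>k\<in>{1..n}. is_segment r (s k)) \<and> disjoint_family_on s {1..n}}"

definition linear_seq_on :: "(nat \<Rightarrow> real) set \<Rightarrow> ((nat \<Rightarrow> real) \<Rightarrow> 'a::real_vector) \<Rightarrow> bool" where
  "linear_seq_on V T \<longleftrightarrow>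
     (\<forall>x\<in>V. \<forall>y\<in>V. T (\<lambda>n. x n + y n) = T x + T y) \<and>
     (\<forall>x\<in>V. \<forall>c. T (\<lambda>n. c * x n) = c *\<^sub>R T x)"

text \<open>
  A completion of \<^const>\<open>c00\<close> under \<^const>\<open>jt_norm\<close> is given by a linear isometry \<open>J\<close> of
  \<^const>\<open>c00\<close> into a Banach space, and is the closure of the range of \<open>J\<close>. The ambient Banach space
  may be larger than the completion: the completion depends on \<open>r\<close> and \<open>p\<close>, so it is realised as
  a closed subspace rather than as a type.
\<close>

definition jt_isometry :: "nat rel \<Rightarrow> real \<Rightarrow> ((nat \<Rightarrow> real) \<Rightarrow> 'a::banach) \<Rightarrow> bool" where
  "jt_isometry r p J \<longleftrightarrow> linear_seq_on c00 J \<and> (\<forall>x\<in>c00. norm (J x) = jt_norm r p x)"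

definition jt_space :: "((nat \<Rightarrow> real) \<Rightarrow> 'a::banach) \<Rightarrow> 'a set" where
  "jt_space J = closure (J ` c00)"

text \<open>
  The coordinate sequence \<open>(x(n))\<close> of a vector \<open>x\<close> with respect to the basis \<open>e\<^sub>n = J (unit_seq n)\<close>.
\<close>

definition jt_coord :: "((nat \<Rightarrow> real) \<Rightarrow> 'a::banach) \<Rightarrow> 'a \<Rightarrow> nat \<Rightarrow> real" where
  "jt_coord J x = (THE c. (\<lambda>n. c n *\<^sub>R J (unit_seq n)) sums x)"

definition jt_restrict :: "((nat \<Rightarrow> real) \<Rightarrow> 'a::banach) \<Rightarrow> nat set \<Rightarrow> 'a \<Rightarrow> 'a" where
  "jt_restrict J A x = (\<Sum>n. if n \<in> A then jt_coord J x n *\<^sub>R J (unit_seq n) else 0)"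

definition lp_space :: "real \<Rightarrow> (nat \<Rightarrow> real) set" where
  "lp_space p = {a. summable (\<lambda>n. \<bar>a n\<bar> powr p)}"

definition lp_norm :: "real \<Rightarrow> (nat \<Rightarrow> real) \<Rightarrow> real" where
  "lp_norm p a = (\<Sum>n. \<bar>a n\<bar> powr p) powr (1 / p)"

definition isomorphic_to_lp :: "real \<Rightarrow> 'a::real_normed_vector set \<Rightarrow> bool" where
  "isomorphic_to_lp p Z \<longleftrightarrow>
     (\<exists>T. linear_seq_on (lp_space p) T \<and> T ` lp_space p = Z \<and>
        (\<exists>C. \<forall>a\<in>lp_space p. norm (T a) \<le> C * lp_norm p a) \<and>
        (\<exists>c>0. \<forall>a\<in>lp_space p. c * lp_norm p a \<le> norm (T a)))"

definition closed_subspace_of :: "'a::real_normed_vector set \<Rightarrow> 'a set \<Rightarrow> bool" where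
  "closed_subspace_of Z Y \<longleftrightarrow> subspace Z \<and> closed Z \<and> Z \<subseteq> Y"

definition finite_codim_in :: "'a::real_vector set \<Rightarrow> 'a set \<Rightarrow> bool" where
  "finite_codim_in Z Y \<longleftrightarrow> (\<exists>F. finite F \<and> F \<subseteq> Y \<and> span (Z \<union> F) = Y)"

definition isomorphism_onto_image_on ::
    "'a::real_normed_vector set \<Rightarrow> ('a \<Rightarrow> 'b::real_normed_vector) \<Rightarrow> bool" where
  "isomorphism_onto_image_on V P \<longleftrightarrow>
     (\<forall>x\<in>V. \<forall>y\<in>V. P (x + y) = P x + P y) \<and>
     (\<forall>x\<in>V. \<forall>c. P (c *\<^sub>R x) = c *\<^sub>R P x) \<and>
     (\<exists>C. \<forall>x\<in>V. norm (P x) \<le> C * norm x) \<and>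
     (\<exists>c>0. \<forall>x\<in>V. c * norm x \<le> norm (P x))"

end

theory Submission
  imports Defs
begin

text \<open>
  Cutting segments at an integer shows that successive blocks satisfy a lower \<open>\<ell>\<^sub>p\<close> estimate with
  constant 1, and they satisfy an upper one as soon as their \<open>\<ell>\<^sub>2\<close> norms on all segments decrease
  fast enough. So it suffices to find, far out in \<open>Y\<close>, unit vectors that are small in \<open>\<ell>\<^sub>2\<close> on every
  segment. If the theorem fails, \<open>Y\<close> contains for each finite set of branches unit vectors that are
  far out and almost vanish on these branches. Such a vector has boundedly many heavy paths, and along
  the net of all such vectors these paths accumulate, by compactness, at finitely many chains, hence
  lie in finitely many branches. Vectors that almost vanish on these branches too, and whose heavy
  paths agree with them on the supports of the preceding vectors, form a sequence of which no segment
  meets two members heavily; its normalised partial sums are the vectors sought.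
\<close>

subsection \<open>Segments and the norm\<close>

text \<open>The basis vectors along a branch span a copy of \<open>\<ell>\<^sub>2\<close>, so blocks
  that keep meeting one segment heavily satisfy no upper \<open>\<ell>\<^sub>p\<close> estimate.
  Avoiding such segments looks circular: the branches at which the heavy paths accumulate are known
  only after the vectors are chosen, while the vectors have to almost vanish on these branches. The
  circle is broken by using the net of all pairs (finite set of branches, starting point) instead of
  a sequence. A cluster point lies in the closure for every index of the net, in particular for the
  index made of the very branches that the cluster point determines. Since a cluster point controls
  only finitely many coordinates at a time, agreement of the paths is available only below a given
  integer; the supports of the preceding blocks do not require more.\<close>

definition energy :: "(nat \<Rightarrow> real) \<Rightarrow> nat set \<Rightarrow> real" where
  "energy x s = (\<Sum>i\<in>s. (x i)\<^sup>2)"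

definition restrict_seq :: "nat set \<Rightarrow> (nat \<Rightarrow> real) \<Rightarrow> nat \<Rightarrow> real" where
  "restrict_seq A x = (\<lambda>n. if n \<in> A then x n else 0)"

lemma energy_nonneg [simp]: "0 \<le> energy x s"
  by (simp add: energy_def sum_nonneg)

lemma energy_empty [simp]: "energy x {} = 0"
  by (simp add: energy_def)

lemma energy_mono: "finite t \<Longrightarrow> s \<subseteq> t \<Longrightarrow> energy x s \<le> energy x t"
  unfolding energy_def by (rule sum_mono2) auto

lemma energy_le_support:
  assumes "x \<in> c00" "finite s"
  shows "energy x s \<le> energy x {n. x n \<noteq> 0}"
proof -
  have "energy x s = energy x (s \<inter> {n. x n \<noteq> 0})"
    unfolding energy_def using assms by (intro sum.mono_neutral_right) auto
  also have "\<dots> \<le> energy x {n. x n \<noteq> 0}"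
    using assms by (intro energy_mono) (auto simp: c00_def)
  finally show ?thesis .
qed

lemma energy_scale: "energy (\<lambda>n. c * x n) s = c\<^sup>2 * energy x s"
  by (simp add: energy_def power_mult_distrib sum_distrib_left)

lemma energy_cong: "(\<And>i. i \<in> s \<Longrightarrow> x i = y i) \<Longrightarrow> energy x s = energy y s"
  unfolding energy_def by (metis (no_types, lifting) sum.cong)

lemma energy_mono_seq: "(\<And>i. \<bar>x i\<bar> \<le> \<bar>y i\<bar>) \<Longrightarrow> energy x s \<le> energy y s"
  unfolding energy_def by (intro sum_mono) (simp add: abs_le_square_iff)

text \<open>Each term is \<open>a i * a i powr (q - 1)\<close>, and the second factor is at most the
  same power of the full sum. With \<open>q = p / 2\<close> this makes the supremum in the norm
  finite.\<close>

lemma sum_powr_le: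
  fixes a :: "'i \<Rightarrow> real"
  assumes "finite I" "1 \<le> q" "\<And>i. i \<in> I \<Longrightarrow> 0 \<le> a i"
  shows "(\<Sum>i\<in>I. a i powr q) \<le> (\<Sum>i\<in>I. a i) powr q"
proof -
  define S where "S = (\<Sum>i\<in>I. a i)"
  have powr_split: "t powr q = t * t powr (q - 1)" if "0 \<le> t" for t :: real
  proof (cases "t = 0")
    case False
    then show ?thesis using that powr_mult_base[of t "q - 1"] by simp
  qed simp
  have aS: "a i \<le> S" if "i \<in> I" for i
    unfolding S_def using assms that by (intro member_le_sum) auto
  have "(\<Sum>i\<in>I. a i powr q) \<le> (\<Sum>i\<in>I. a i * S powr (q - 1))"
  proof (rule sum_mono)
    fix i assume i: "i \<in> I"
    have "a i powr (q - 1) \<le> S powr (q - 1)"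
      using assms i aS by (intro powr_mono2) auto
    then show "a i powr q \<le> a i * S powr (q - 1)"
      using powr_split[of "a i"] assms(3)[OF i] by (simp add: mult_left_mono)
  qed
  also have "\<dots> = S * S powr (q - 1)" by (simp add: S_def sum_distrib_right)
  also have "\<dots> = S powr q"
    using assms by (subst powr_split) (auto simp: S_def sum_nonneg)
  finally show ?thesis by (simp add: S_def)
qed

lemma powr_add_le:
  fixes u v q :: real
  assumes "0 \<le> u" "0 \<le> v" "0 \<le> q"
  shows "(u + v) powr q \<le> 2 powr q * (u powr q + v powr q)"
proof -
  have "(u + v) powr q \<le> (2 * max u v) powr q"
    using assms by (intro powr_mono2) auto
  also have "\<dots> = 2 powr q * (max u v) powr q"
    using assms by (simp add: powr_mult)
  also have "\<dots> \<le> 2 powr q * (u powr q + v powr q)"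
    by (intro mult_left_mono) (auto simp: max_def)
  finally show ?thesis .
qed

lemma c00_add [intro]: "x \<in> c00 \<Longrightarrow> y \<in> c00 \<Longrightarrow> (\<lambda>n. x n + y n) \<in> c00"
  unfolding c00_def
  by (auto intro: finite_subset[where B = "{n. x n \<noteq> 0} \<union> {n. y n \<noteq> 0}"])

lemma c00_diff [intro]: "x \<in> c00 \<Longrightarrow> y \<in> c00 \<Longrightarrow> (\<lambda>n. x n - y n) \<in> c00"
  unfolding c00_def
  by (auto intro: finite_subset[where B = "{n. x n \<noteq> 0} \<union> {n. y n \<noteq> 0}"])

lemma c00_scale [intro]: "x \<in> c00 \<Longrightarrow> (\<lambda>n. c * x n) \<in> c00"
  unfolding c00_def by (auto intro: finite_subset[where B = "{n. x n \<noteq> 0}"])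

lemma c00_restrict [intro]: "x \<in> c00 \<Longrightarrow> restrict_seq A x \<in> c00"
  unfolding c00_def restrict_seq_def by (auto intro: finite_subset[where B = "{n. x n \<noteq> 0}"])

lemma c00_restrict_lessThan [intro]: "restrict_seq {..<N} x \<in> c00"
  unfolding c00_def restrict_seq_def by (auto intro: finite_subset[where B = "{..<N}"])

lemma c00_sum:
  assumes "finite I" "\<And>i. i \<in> I \<Longrightarrow> x i \<in> c00"
  shows "(\<lambda>n. \<Sum>i\<in>I. x i n) \<in> c00"
  using assms
proof (induction I rule: finite_induct)
  case empty
  then show ?case by (simp add: c00_def)
next
  case (insert i I)
  then show ?case using c00_add[of "x i" "\<lambda>n. \<Sum>i\<in>I. x i n"] by simp
qed

lemma c00_bounded: "x \<in> c00 \<Longrightarrow> \<exists>M. \<forall>n\<ge>M. x n = 0"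
  unfolding c00_def by (smt (verit) finite_nat_set_iff_bounded mem_Collect_eq not_le)

section \<open>Segments of the tree\<close>

locale jt_tree =
  fixes r :: "nat rel" and p :: real
  assumes tree: "infinitely_branching_tree r" and p: "2 < p"
begin

abbreviation down :: "nat \<Rightarrow> nat set" where
  "down n \<equiv> {k. (k, n) \<in> r}"

lemma r_refl [simp]: "(n, n) \<in> r"
  using tree by (auto simp: infinitely_branching_tree_def partial_order_on_def preorder_on_def refl_on_def)

lemma r_trans: "(a, b) \<in> r \<Longrightarrow> (b, c) \<in> r \<Longrightarrow> (a, c) \<in> r"
  using tree unfolding infinitely_branching_tree_def partial_order_on_def preorder_on_def
  by (meson transD)

lemma r_le: "(a, b) \<in> r \<Longrightarrow> a \<le> b"
  using tree by (auto simp: infinitely_branching_tree_def)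

lemma r_comparable: "(a, n) \<in> r \<Longrightarrow> (b, n) \<in> r \<Longrightarrow> (a, b) \<in> r \<or> (b, a) \<in> r"
  using tree by (auto simp: infinitely_branching_tree_def Chains_def)

lemma r_of_le: "(a, n) \<in> r \<Longrightarrow> (b, n) \<in> r \<Longrightarrow> a \<le> b \<Longrightarrow> (a, b) \<in> r"
  by (metis r_comparable r_le le_antisym)

lemma segment_finite: "is_segment r s \<Longrightarrow> finite s"
  unfolding is_segment_def using r_le by (elim exE conjE) (auto intro: finite_subset[OF _ finite_atMost])

lemma segment_in_down: "is_segment r s \<Longrightarrow> \<exists>n. s \<subseteq> down n"
  unfolding is_segment_def by blast

text \<open>Inside one \<open>down n\<close> the tree order agrees with the order of the integers,
  so a convex set runs from its minimum to its maximum.\<close>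

lemma is_segmentI:
  assumes "finite s" "s \<noteq> {}" "s \<subseteq> down n"
    and convex: "\<And>a b k. a \<in> s \<Longrightarrow> b \<in> s \<Longrightarrow> (a, k) \<in> r \<Longrightarrow> (k, b) \<in> r \<Longrightarrow> k \<in> s"
  shows "is_segment r s"
proof -
  have M: "Min s \<in> s" "Max s \<in> s" using assms by auto
  have dn: "(k, n) \<in> r" if "k \<in> s" for k using assms(3) that by blast
  have "(Min s, k) \<in> r" "(k, Max s) \<in> r" if "k \<in> s" for k
    using r_of_le[OF dn[OF M(1)] dn[OF that]] r_of_le[OF dn[OF that] dn[OF M(2)]] that assms(1)
    by auto
  then show ?thesis
    unfolding is_segment_def using M convex by blast
qed

text \<open>Cutting a segment at an integer may leave nothing, whereas \<open>is_segment\<close>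
  forces a nonempty set.\<close>

definition segment_or_empty :: "nat set \<Rightarrow> bool" where
  "segment_or_empty s \<longleftrightarrow> s = {} \<or> is_segment r s"

lemma segment_or_empty_Int:
  assumes "is_segment r s" and "\<And>a b k. a \<in> I \<Longrightarrow> b \<in> I \<Longrightarrow> a \<le> k \<Longrightarrow> k \<le> b \<Longrightarrow> k \<in> I"
  shows "segment_or_empty (s \<inter> I)"
proof (cases "s \<inter> I = {}")
  case False
  obtain m n where s: "s = {k. (m, k) \<in> r \<and> (k, n) \<in> r}"
    using assms by (auto simp: is_segment_def)
  have "is_segment r (s \<inter> I)"
  proof (rule is_segmentI[where n = n])
    fix a b k assume "a \<in> s \<inter> I" "b \<in> s \<inter> I" "(a, k) \<in> r" "(k, b) \<in> r"
    then show "k \<in> s \<inter> I"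
      unfolding s using r_trans[of m a k] r_trans[of k b n] r_le[of a k] r_le[of k b] assms(2)[of a b k]
      by simp
  qed (use False assms segment_finite s in auto)
  then show ?thesis by (simp add: segment_or_empty_def)
qed (simp add: segment_or_empty_def)

lemma down_segment: "is_segment r (down n)"
proof (rule is_segmentI)
  show "finite (down n)" using r_le finite_subset[of "down n" "{..n}"] by auto
  show "down n \<noteq> {}" using r_refl by blast
  show "down n \<subseteq> down n" ..
qed (use r_trans in blast)

lemma finite_down [simp]: "finite (down n)"
  by (rule segment_finite) (rule down_segment)

lemma segment_singleton: "is_segment r {n}"
  by (rule is_segmentI[where n = n]) (auto dest: r_le intro: le_antisym)

text \<open>The index type is arbitrary, so that two families can be joined along the disjoint sum
  of their index sets.\<close>

definition disjoint_segments :: "'i set \<Rightarrow> ('i \<Rightarrow> nat set) \<Rightarrow> bool" where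
  "disjoint_segments I s \<longleftrightarrow> finite I \<and> (\<forall>i\<in>I. segment_or_empty (s i)) \<and> disjoint_family_on s I"

lemma disjoint_segments_energy:
  assumes "x \<in> c00" "disjoint_segments I s"
  shows "(\<Sum>i\<in>I. energy x (s i) powr (p / 2)) \<le> energy x {n. x n \<noteq> 0} powr (p / 2)"
proof -
  have fin: "finite (s i)" if "i \<in> I" for i
    using assms that segment_finite by (auto simp: disjoint_segments_def segment_or_empty_def)
  have "(\<Sum>i\<in>I. energy x (s i) powr (p / 2)) \<le> (\<Sum>i\<in>I. energy x (s i)) powr (p / 2)"
    using assms p by (intro sum_powr_le) (auto simp: disjoint_segments_def)
  also have "(\<Sum>i\<in>I. energy x (s i)) = energy x (\<Union>i\<in>I. s i)"
    unfolding energy_def using assms fin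
    by (intro sum.UNION_disjoint[symmetric]) (auto simp: disjoint_segments_def disjoint_family_on_def)
  also have "\<dots> powr (p / 2) \<le> energy x {n. x n \<noteq> 0} powr (p / 2)"
    using p fin assms by (intro powr_mono2 energy_le_support) (auto simp: disjoint_segments_def)
  finally show ?thesis .
qed

section \<open>The norm as a supremum over disjoint families\<close>

abbreviation jt_set :: "(nat \<Rightarrow> real) \<Rightarrow> real set" where
  "jt_set x \<equiv> {(\<Sum>k=1..n. (\<Sum>i\<in>s k. (x i)\<^sup>2) powr (p / 2)) powr (1 / p) |n (s :: nat \<Rightarrow> nat set).
     1 \<le> n \<and> (\<forall>k\<in>{1..n}. is_segment r (s k)) \<and> disjoint_family_on s {1..n}}"

lemma jt_setE:
  assumes "v \<in> jt_set x"
  obtains n :: nat and s where "v = (\<Sum>k=1..n. energy x (s k) powr (p / 2)) powr (1 / p)" "1 \<le> n"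
    "\<forall>k\<in>{1..n}. is_segment r (s k)" "disjoint_family_on s {1..n}"
  using assms by (elim CollectE exE conjE) (rule that[unfolded energy_def])

lemma jt_setI:
  fixes n :: nat
  assumes "1 \<le> n" "\<forall>k\<in>{1..n}. is_segment r (s k)" "disjoint_family_on s {1..n}"
  shows "(\<Sum>k=1..n. energy x (s k) powr (p / 2)) powr (1 / p) \<in> jt_set x"
  using assms unfolding energy_def by (intro CollectI exI conjI) auto

lemma bdd_above_jt_set:
  assumes "x \<in> c00" shows "bdd_above (jt_set x)"
proof (rule bdd_aboveI)
  fix v assume "v \<in> jt_set x"
  then obtain n :: nat and s where v: "v = (\<Sum>k=1..n. energy x (s k) powr (p / 2)) powr (1 / p)"
    and s: "\<forall>k\<in>{1..n}. is_segment r (s k)" "disjoint_family_on s {1..n}"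
    by (elim jt_setE) (rule that)
  have "disjoint_segments {1..n} s" using s by (auto simp: disjoint_segments_def segment_or_empty_def)
  from disjoint_segments_energy[OF assms this]
  show "v \<le> (energy x {n. x n \<noteq> 0} powr (p / 2)) powr (1 / p)"
    unfolding v using p by (intro powr_mono2) (auto intro: sum_nonneg)
qed

lemma jt_set_singleton: "((x n)\<^sup>2 powr (p / 2)) powr (1 / p) \<in> jt_set x"
  using jt_setI[of 1 "\<lambda>_. {n}" x] segment_singleton
  by (simp add: energy_def disjoint_family_on_def)

lemma jt_norm_nonneg: "x \<in> c00 \<Longrightarrow> 0 \<le> jt_norm r p x"
  unfolding jt_norm_def
  by (rule cSup_upper2[OF jt_set_singleton[of x 0] _ bdd_above_jt_set]) auto

text \<open>Empty members contribute nothing and are dropped; the others are numbered from 1, which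
  gives a family that the supremum admits.\<close>

lemma disjoint_segments_le_norm:
  assumes x: "x \<in> c00" and s: "disjoint_segments I s"
  shows "(\<Sum>i\<in>I. energy x (s i) powr (p / 2)) \<le> jt_norm r p x powr p"
proof -
  define I' where "I' = {i\<in>I. s i \<noteq> {}}"
  have fin: "finite I'" and seg: "\<And>i. i \<in> I' \<Longrightarrow> is_segment r (s i)" and dis: "disjoint_family_on s I'"
    using s by (auto simp: disjoint_segments_def segment_or_empty_def I'_def disjoint_family_on_def)
  have eq: "(\<Sum>i\<in>I. energy x (s i) powr (p / 2)) = (\<Sum>i\<in>I'. energy x (s i) powr (p / 2))"
    using s by (intro sum.mono_neutral_right) (auto simp: disjoint_segments_def I'_def)
  show ?thesis
  proof (cases "I' = {}")
    case True
    then show ?thesis unfolding eq by simp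
  next
    case False
    define n where "n = card I'"
    obtain h where h: "bij_betw h {1..n} I'"
      using ex_bij_betw_nat_finite_1[OF fin] unfolding n_def by blast
    have n: "1 \<le> n" using False fin by (simp add: n_def Suc_le_eq card_gt_0_iff)
    have "(\<Sum>i\<in>I'. energy x (s i) powr (p / 2)) = (\<Sum>k=1..n. energy x (s (h k)) powr (p / 2))"
      by (rule sum.reindex_bij_betw[OF h, symmetric])
    moreover have "\<forall>k\<in>{1..n}. is_segment r ((s \<circ> h) k)"
      using h seg bij_betwE by fastforce
    moreover have "disjoint_family_on (s \<circ> h) {1..n}"
      using dis h unfolding disjoint_family_on_def bij_betw_def inj_on_def by fastforce
    ultimately have "(\<Sum>i\<in>I'. energy x (s i) powr (p / 2)) powr (1 / p) \<in> jt_set x"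
      using n jt_setI[of n "s \<circ> h" x] by simp
    then have "(\<Sum>i\<in>I'. energy x (s i) powr (p / 2)) powr (1 / p) \<le> jt_norm r p x"
      unfolding jt_norm_def by (rule cSup_upper) (rule bdd_above_jt_set[OF x])
    then have "((\<Sum>i\<in>I'. energy x (s i) powr (p / 2)) powr (1 / p)) powr p \<le> jt_norm r p x powr p"
      using p by (intro powr_mono2) auto
    then show ?thesis unfolding eq using p by (simp add: powr_powr sum_nonneg)
  qed
qed

text \<open>Together with \<open>disjoint_segments_le_norm\<close> this replaces the supremum in all
  later arguments; passing to p-th powers removes the outer root.\<close>

lemma jt_norm_powr_leI:
  assumes x: "x \<in> c00"
    and le: "\<And>n s. disjoint_segments {1..n::nat} s \<Longrightarrow> \<forall>k\<in>{1..n}. is_segment r (s k) \<Longrightarrow>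
      (\<Sum>k=1..n. energy x (s k) powr (p / 2)) \<le> C"
  shows "jt_norm r p x powr p \<le> C"
proof -
  \<comment> \<open>The hypothesis includes the empty family \<open>n = 0\<close>, whose sum is
    0.\<close>
  have C: "0 \<le> C" using le[of 0 "\<lambda>_. {}"] by (simp add: disjoint_segments_def disjoint_family_on_def)
  have "jt_norm r p x \<le> C powr (1 / p)"
    unfolding jt_norm_def
  proof (rule cSup_least)
    show "jt_set x \<noteq> {}" using jt_set_singleton by blast
  next
    fix v assume "v \<in> jt_set x"
    then obtain n :: nat and s where v: "v = (\<Sum>k=1..n. energy x (s k) powr (p / 2)) powr (1 / p)"
      and s: "\<forall>k\<in>{1..n}. is_segment r (s k)" "disjoint_family_on s {1..n}"
      by (elim jt_setE) (rule that)
    have "disjoint_segments {1..n} s" using s by (auto simp: disjoint_segments_def segment_or_empty_def)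
    from le[OF this s(1)] show "v \<le> C powr (1 / p)"
      unfolding v using p by (intro powr_mono2) (auto intro: sum_nonneg)
  qed
  then have "jt_norm r p x powr p \<le> (C powr (1 / p)) powr p"
    using p jt_norm_nonneg[OF x] by (intro powr_mono2) auto
  then show ?thesis using C p by (simp add: powr_powr)
qed

lemma segment_energy_le_norm:
  assumes "x \<in> c00" "is_segment r s"
  shows "energy x s \<le> (jt_norm r p x)\<^sup>2"
proof -
  have "disjoint_segments {()} (\<lambda>_. s)"
    using assms by (auto simp: disjoint_segments_def disjoint_family_on_def segment_or_empty_def)
  from disjoint_segments_le_norm[OF assms(1) this]
  have "energy x s powr (p / 2) \<le> jt_norm r p x powr p" by simp
  then have "(energy x s powr (p / 2)) powr (2 / p) \<le> (jt_norm r p x powr p) powr (2 / p)"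
    using p by (intro powr_mono2) auto
  then show ?thesis using p jt_norm_nonneg[OF assms(1)] by (simp add: powr_powr)
qed

lemma coord_le_norm: "x \<in> c00 \<Longrightarrow> \<bar>x n\<bar> \<le> jt_norm r p x"
  using segment_energy_le_norm[OF _ segment_singleton, of x n] jt_norm_nonneg[of x]
  by (simp add: energy_def abs_le_square_iff[symmetric])

text \<open>This is the 1-unconditionality of the basis: neither restrictions nor changes of sign
  increase the norm.\<close>

lemma jt_norm_mono:
  assumes "x \<in> c00" "y \<in> c00" "\<And>i. \<bar>x i\<bar> \<le> \<bar>y i\<bar>"
  shows "jt_norm r p x \<le> jt_norm r p y"
proof -
  have "jt_norm r p x powr p \<le> jt_norm r p y powr p"
  proof (rule jt_norm_powr_leI[OF assms(1)])
    fix n :: nat and s assume s: "disjoint_segments {1..n} s"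
    have "(\<Sum>k=1..n. energy x (s k) powr (p / 2)) \<le> (\<Sum>k=1..n. energy y (s k) powr (p / 2))"
      using p assms by (intro sum_mono powr_mono2 energy_mono_seq) auto
    also have "\<dots> \<le> jt_norm r p y powr p" by (rule disjoint_segments_le_norm[OF assms(2) s])
    finally show "(\<Sum>k=1..n. energy x (s k) powr (p / 2)) \<le> jt_norm r p y powr p" .
  qed
  then show ?thesis
    using p jt_norm_nonneg[OF assms(1)] jt_norm_nonneg[OF assms(2)]
    by (meson not_le powr_less_mono2 dual_order.strict_trans zero_less_numeral)
qed

text \<open>Segments can be cut at \<open>N\<close>, so that families for \<open>x\<close> and for \<open>y\<close> become jointly disjoint.\<close>

lemma jt_norm_powr_superadd:
  assumes x: "x \<in> c00" and y: "y \<in> c00"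
    and xN: "\<And>n. N \<le> n \<Longrightarrow> x n = 0" and yN: "\<And>n. n < N \<Longrightarrow> y n = 0"
  shows "jt_norm r p x powr p + jt_norm r p y powr p \<le> jt_norm r p (\<lambda>n. x n + y n) powr p"
    (is "_ \<le> ?R")
proof -
  have both: "(\<Sum>k=1..n. energy x (s k) powr (p / 2)) + (\<Sum>k=1..m. energy y (t k) powr (p / 2)) \<le> ?R"
    if s: "disjoint_segments {1..n::nat} s" "\<forall>k\<in>{1..n}. is_segment r (s k)"
      and t: "disjoint_segments {1..m::nat} t" "\<forall>k\<in>{1..m}. is_segment r (t k)" for n m s t
  proof -
    define u where "u = case_sum (\<lambda>k. s k \<inter> {..<N}) (\<lambda>k. t k \<inter> {N..})"
    have u: "disjoint_segments ({1..n} <+> {1..m}) u"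
    proof -
      have sd: "i = j" if "a \<in> s i" "a \<in> s j" "i \<in> {1..n}" "j \<in> {1..n}" for i j a
        using s(1) that unfolding disjoint_segments_def disjoint_family_on_def by (metis IntI empty_iff)
      have td: "i = j" if "a \<in> t i" "a \<in> t j" "i \<in> {1..m}" "j \<in> {1..m}" for i j a
        using t(1) that unfolding disjoint_segments_def disjoint_family_on_def by (metis IntI empty_iff)
      have "disjoint_family_on u ({1..n} <+> {1..m})"
        unfolding disjoint_family_on_def u_def using sd td by auto
      then show ?thesis
        using s t unfolding disjoint_segments_def u_def by (auto intro!: segment_or_empty_Int)
    qed
    have xN': "i < N" if "x i \<noteq> 0" for i using xN[of i] that by linarith
    have yN': "N \<le> i" if "y i \<noteq> 0" for i using yN[of i] that by linarith
    have fs: "finite (s k)" if "k \<in> {1..n}" for k using s(2) segment_finite that by blast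
    have ft: "finite (t k)" if "k \<in> {1..m}" for k using t(2) segment_finite that by blast
    have es: "energy x (s k) = energy (\<lambda>n. x n + y n) (s k \<inter> {..<N})" if "k \<in> {1..n}" for k
    proof -
      have "energy x (s k) = energy x (s k \<inter> {..<N})"
        unfolding energy_def using fs[OF that] xN'
        by (intro sum.mono_neutral_right) auto
      then show ?thesis using yN by (simp add: energy_def)
    qed
    have et: "energy y (t k) = energy (\<lambda>n. x n + y n) (t k \<inter> {N..})" if "k \<in> {1..m}" for k
    proof -
      have "energy y (t k) = energy y (t k \<inter> {N..})"
        unfolding energy_def using ft[OF that] yN'
        by (intro sum.mono_neutral_right) auto
      then show ?thesis using xN by (simp add: energy_def)
    qed
    have "(\<Sum>i\<in>{1..n} <+> {1..m}. energy (\<lambda>n. x n + y n) (u i) powr (p / 2)) \<le> ?R"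
      by (rule disjoint_segments_le_norm[OF c00_add[OF x y] u])
    then show ?thesis by (simp add: sum.Plus es et u_def)
  qed
  \<comment> \<open>The two suprema are taken one after the other: over \<open>s\<close> with
    \<open>t\<close> fixed, then over \<open>t\<close>.\<close>
  have "jt_norm r p x powr p \<le> ?R - (\<Sum>k=1..m. energy y (t k) powr (p / 2))"
    if "disjoint_segments {1..m::nat} t" "\<forall>k\<in>{1..m}. is_segment r (t k)" for m t
    by (rule jt_norm_powr_leI[OF x]) (use both that in \<open>simp add: le_diff_eq\<close>)
  then have "jt_norm r p y powr p \<le> ?R - jt_norm r p x powr p"
    by (intro jt_norm_powr_leI[OF y]) (simp add: algebra_simps)
  then show ?thesis by simp
qed

end

subsection \<open>Successive blocks\<close>

text \<open>At each coordinate at most one summand is nonzero, so squaring the sum produces no mixed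
  terms.\<close>

lemma energy_sum_blocks:
  assumes I: "finite I" and dis: "\<And>i j k. i \<in> I \<Longrightarrow> j \<in> I \<Longrightarrow> x i k \<noteq> 0 \<Longrightarrow> x j k \<noteq> 0 \<Longrightarrow> i = j"
  shows "energy (\<lambda>k. \<Sum>i\<in>I. x i k) s = (\<Sum>i\<in>I. energy (x i) s)"
proof -
  have "(\<Sum>i\<in>I. x i k)\<^sup>2 = (\<Sum>i\<in>I. (x i k)\<^sup>2)" for k
  proof (cases "\<exists>i\<in>I. x i k \<noteq> 0")
    case True
    then obtain i where i: "i \<in> I" "x i k \<noteq> 0" by blast
    have "\<forall>j\<in>I - {i}. x j k = 0" using dis i by blast
    then have "(\<Sum>j\<in>I. x j k) = (\<Sum>j\<in>{i}. x j k)" "(\<Sum>j\<in>I. (x j k)\<^sup>2) = (\<Sum>j\<in>{i}. (x j k)\<^sup>2)"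
      using I i by (intro sum.mono_neutral_right; simp)+
    then show ?thesis by simp
  qed simp
  then show ?thesis unfolding energy_def by (simp add: sum.swap[of _ s])
qed

text \<open>The starting points belong to the data because \<open>b k\<close> bounds the number of
  disjoint segments with a point before block \<open>k\<close>. Since \<open>b\<close> is merely
  monotone, zero blocks are possible.\<close>

definition blocks :: "(nat \<Rightarrow> nat) \<Rightarrow> (nat \<Rightarrow> nat \<Rightarrow> real) \<Rightarrow> bool" where
  "blocks b x \<longleftrightarrow> mono b \<and> (\<forall>j. x j \<in> c00) \<and> (\<forall>j k. x j k \<noteq> 0 \<longrightarrow> b j \<le> k \<and> k < b (Suc j))"

lemma blocks_scale: "blocks b x \<Longrightarrow> blocks b (\<lambda>j k. a j * x j k)"
  by (auto simp: blocks_def)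

lemma blocks_disjoint:
  assumes "blocks b x" "x i k \<noteq> 0" "x j k \<noteq> 0"
  shows "i = j"
proof (rule ccontr)
  assume "i \<noteq> j"
  moreover have False if "i < j" "x i k \<noteq> 0" "x j k \<noteq> 0" for i j
  proof -
    have "b (Suc i) \<le> b j" using that assms(1) by (auto simp: blocks_def intro: monoD)
    then show False using that assms(1) unfolding blocks_def by (meson leD order_trans)
  qed
  ultimately show False using assms by (meson linorder_neqE_nat)
qed

lemma blocks_energy_sum:
  "blocks b x \<Longrightarrow> finite I \<Longrightarrow> energy (\<lambda>k. \<Sum>i\<in>I. x i k) s = (\<Sum>i\<in>I. energy (x i) s)"
  by (rule energy_sum_blocks) (auto dest: blocks_disjoint)

lemma blocks_sum_c00: "blocks b x \<Longrightarrow> finite I \<Longrightarrow> (\<lambda>k. \<Sum>i\<in>I. x i k) \<in> c00"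
  by (rule c00_sum) (auto simp: blocks_def)

lemma (in jt_tree) blocks_lower_estimate:
  assumes x: "blocks b x"
  shows "(\<Sum>j<m. jt_norm r p (x j) powr p) \<le> jt_norm r p (\<lambda>k. \<Sum>j<m. x j k) powr p"
proof (induction m)
  case (Suc m)
  have "(\<Sum>j<m. x j k) = 0" if "b m \<le> k" for k
  proof (rule sum.neutral, intro ballI, rule ccontr)
    fix j assume j: "j \<in> {..<m}" "x j k \<noteq> 0"
    then have "k < b (Suc j)" "b (Suc j) \<le> b m" using x by (auto simp: blocks_def intro: monoD)
    then show False using that by simp
  qed
  moreover have "x m k = 0" if "k < b m" for k
    using x that unfolding blocks_def by (meson leD)
  ultimately have "jt_norm r p (\<lambda>k. \<Sum>j<m. x j k) powr p + jt_norm r p (x m) powr p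
      \<le> jt_norm r p (\<lambda>k. (\<Sum>j<m. x j k) + x m k) powr p"
    using x blocks_sum_c00[OF x] by (intro jt_norm_powr_superadd[where N = "b m"]) (auto simp: blocks_def)
  then show ?case using Suc by simp
qed simp

lemma powr_sum_single:
  fixes f :: "'i \<Rightarrow> real"
  assumes I: "finite I" and single: "\<And>i j. i \<in> I \<Longrightarrow> j \<in> I \<Longrightarrow> f i \<noteq> 0 \<Longrightarrow> f j \<noteq> 0 \<Longrightarrow> i = j"
  shows "(\<Sum>i\<in>I. f i) powr q = (\<Sum>i\<in>I. f i powr q)"
proof (cases "\<exists>i\<in>I. f i \<noteq> 0")
  case True
  then obtain i where i: "i \<in> I" "f i \<noteq> 0" by blast
  have "\<forall>j\<in>I - {i}. f j = 0" using single i by blast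
  then have "(\<Sum>j\<in>I. f j) = (\<Sum>j\<in>{i}. f j)" "(\<Sum>j\<in>I. f j powr q) = (\<Sum>j\<in>{i}. f j powr q)"
    using I i by (intro sum.mono_neutral_right; simp)+
  then show ?thesis by simp
qed simp

lemma square_powr_half: "(t :: real)\<^sup>2 powr (q / 2) = \<bar>t\<bar> powr q"
proof (cases "t = 0")
  case False
  then have "t\<^sup>2 = \<bar>t\<bar> powr 2" by simp
  then show ?thesis by (simp only: powr_powr) simp
qed simp

lemma sum_half_powers_le: "finite K \<Longrightarrow> (\<Sum>k\<in>K. (1 / 2 :: real) ^ Suc k) \<le> 1"
  using sum_le_suminf[OF sums_summable[OF power_half_series], of K] sums_unique[OF power_half_series]
  by simp

context jt_tree
begin

text \<open>A segment splits into the part it has in the first block that it meets and the rest; only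
  \<open>b k\<close> disjoint segments can meet a block before the \<open>k\<close>-th one, and this is outweighed by the
  smallness of the energies in block \<open>k\<close>.\<close>

lemma blocks_upper_estimate:
  assumes x: "blocks b x" and K: "finite K"
    and norm: "\<And>k. jt_norm r p (x k) \<le> 1"
    and small: "\<And>k s. is_segment r s \<Longrightarrow> energy (x k) s * (b k + 1) \<le> (1 / 2) ^ Suc k"
  shows "jt_norm r p (\<lambda>i. \<Sum>k\<in>K. a k * x k i) powr p \<le>
    2 powr (p / 2) * (2 * (\<Sum>k\<in>K. \<bar>a k\<bar> powr p))"
proof (rule jt_norm_powr_leI)
  have ax: "blocks b (\<lambda>k i. a k * x k i)" by (rule blocks_scale) (rule x)
  show "(\<lambda>i. \<Sum>k\<in>K. a k * x k i) \<in> c00" by (rule blocks_sum_c00[OF ax K])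
  define S where "S = (\<Sum>k\<in>K. \<bar>a k\<bar> powr p)"
  have S: "0 \<le> S" by (simp add: S_def sum_nonneg)
  fix n :: nat and s
  assume ds: "disjoint_segments {1..n} s" and seg: "\<forall>j\<in>{1..n}. is_segment r (s j)"
  \<comment> \<open>A segment with energy in block \<open>k\<close> but no point before it sees
    block \<open>k\<close> first. So \<open>U\<close> carries the first block seen by a segment and
    \<open>V\<close> the others.\<close>
  define meets where "meets k j \<longleftrightarrow> s j \<inter> {..<b k} \<noteq> {}" for k j
  define e where "e k j = energy (x k) (s j)" for k j
  define U where "U j = (\<Sum>k | k \<in> K \<and> \<not> meets k j. (a k)\<^sup>2 * e k j)" for j
  define V where "V j = (\<Sum>k | k \<in> K \<and> meets k j. (a k)\<^sup>2 * e k j)" for j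
  \<comment> \<open>By \<open>small\<close>, \<open>w k\<close> bounds every \<open>e k j\<close>.
    The factor \<open>b k + 1\<close> will absorb the number of segments with
    \<open>meets k j\<close>; the 1 keeps the denominator positive when
    \<open>b k = 0\<close>.\<close>
  define w where "w k = (1 / 2) ^ Suc k / (real (b k) + 1)" for k
  define W where "W j = (\<Sum>k | k \<in> K \<and> meets k j. w k)" for j
  have e0: "0 \<le> e k j" for k j by (simp add: e_def)
  have w0: "0 \<le> w k" and w1: "w k \<le> (1 / 2) ^ Suc k" for k
  proof -
    show "0 \<le> w k" by (simp add: w_def)
    have "(1 / 2 :: real) ^ Suc k * 1 \<le> (1 / 2) ^ Suc k * (real (b k) + 1)"
      by (intro mult_left_mono) auto
    then show "w k \<le> (1 / 2) ^ Suc k" by (simp add: w_def divide_le_eq)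
  qed
  have ew: "e k j \<le> w k" if "j \<in> {1..n}" for k j
    using small[of "s j" k] seg that by (simp add: e_def w_def le_divide_eq add.commute del: power_Suc)
  have U0: "0 \<le> U j" and V0: "0 \<le> V j" for j
    unfolding U_def V_def by (auto intro!: sum_nonneg simp: e0)
  have split: "energy (\<lambda>i. \<Sum>k\<in>K. a k * x k i) (s j) = U j + V j" for j
  proof -
    have "energy (\<lambda>i. \<Sum>k\<in>K. a k * x k i) (s j) = (\<Sum>k\<in>K. (a k)\<^sup>2 * e k j)"
      by (simp add: blocks_energy_sum[OF ax K] energy_scale e_def)
    also have "\<dots> = (\<Sum>k | k \<in> K \<and> \<not> meets k j. (a k)\<^sup>2 * e k j) + (\<Sum>k | k \<in> K \<and> meets k j. (a k)\<^sup>2 * e k j)"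
      using K by (subst sum.union_disjoint[symmetric]) (auto intro!: sum.cong)
    finally show ?thesis by (simp add: U_def V_def)
  qed
  have nonzero: "b k < b (Suc k) \<and> meets (Suc k) j" if "e k j \<noteq> 0" for k j
  proof -
    have "\<not> (\<forall>i\<in>s j. (x k i)\<^sup>2 = 0)"
      using that unfolding e_def energy_def by (metis sum.neutral)
    then obtain i where "i \<in> s j" "x k i \<noteq> 0" by auto
    then show ?thesis using x by (force simp: blocks_def meets_def)
  qed
  have meets_mono: "meets k' j" if m: "meets k j" "k \<le> k'" for k k' j
  proof -
    have "b k \<le> b k'" using x m by (auto simp: blocks_def intro: monoD)
    moreover obtain i where "i \<in> s j" "i < b k" using m(1) by (auto simp: meets_def)
    ultimately have "i \<in> s j \<inter> {..<b k'}" by simp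
    then show ?thesis unfolding meets_def by (metis empty_iff)
  qed
  \<comment> \<open>Energy in the earlier of two blocks gives the segment a point before the later
    one. So at most one term of \<open>U j\<close> is nonzero, and the power can be taken
    termwise.\<close>
  have single: "k = k'" if "e k j \<noteq> 0" "\<not> meets k j" "e k' j \<noteq> 0" "\<not> meets k' j" for k k' j
  proof (rule ccontr)
    assume "k \<noteq> k'"
    then consider "Suc k \<le> k'" | "Suc k' \<le> k" by linarith
    then show False using that nonzero meets_mono by cases blast+
  qed
  have "U j powr (p / 2) \<le> (\<Sum>k\<in>K. \<bar>a k\<bar> powr p * e k j powr (p / 2))" for j
  proof -
    have "U j powr (p / 2) = (\<Sum>k | k \<in> K \<and> \<not> meets k j. ((a k)\<^sup>2 * e k j) powr (p / 2))"
      unfolding U_def using K single by (intro powr_sum_single) auto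
    also have "\<dots> \<le> (\<Sum>k\<in>K. ((a k)\<^sup>2 * e k j) powr (p / 2))"
      using K by (intro sum_mono2) auto
    also have "\<dots> = (\<Sum>k\<in>K. \<bar>a k\<bar> powr p * e k j powr (p / 2))"
    proof (rule sum.cong[OF refl])
      fix k
      have "(a k)\<^sup>2 powr (p / 2) = \<bar>a k\<bar> powr p" by (rule square_powr_half)
      then show "((a k)\<^sup>2 * e k j) powr (p / 2) = \<bar>a k\<bar> powr p * e k j powr (p / 2)"
        by (simp add: powr_mult e0)
    qed
    finally show ?thesis .
  qed
  then have "(\<Sum>j=1..n. U j powr (p / 2)) \<le> (\<Sum>j=1..n. \<Sum>k\<in>K. \<bar>a k\<bar> powr p * e k j powr (p / 2))"
    by (intro sum_mono)
  also have "\<dots> = (\<Sum>k\<in>K. \<bar>a k\<bar> powr p * (\<Sum>j=1..n. e k j powr (p / 2)))"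
    by (subst sum.swap) (simp add: sum_distrib_left)
  also have "\<dots> \<le> (\<Sum>k\<in>K. \<bar>a k\<bar> powr p * 1)"
  proof (intro sum_mono mult_left_mono)
    fix k
    have "(\<Sum>j=1..n. e k j powr (p / 2)) \<le> jt_norm r p (x k) powr p"
      unfolding e_def using x by (intro disjoint_segments_le_norm ds) (auto simp: blocks_def)
    also have "\<dots> \<le> 1 powr p"
      using norm[of k] p x jt_norm_nonneg[of "x k"] by (intro powr_mono2) (auto simp: blocks_def)
    finally show "(\<Sum>j=1..n. e k j powr (p / 2)) \<le> 1" by simp
  qed auto
  finally have US: "(\<Sum>j=1..n. U j powr (p / 2)) \<le> S" by (simp add: S_def)

  have a_le: "(a k)\<^sup>2 \<le> S powr (2 / p)" if "k \<in> K" for k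
  proof -
    have "\<bar>a k\<bar> powr p \<le> S" unfolding S_def using K that by (intro member_le_sum) auto
    then have "(\<bar>a k\<bar> powr p) powr (2 / p) \<le> S powr (2 / p)" using p by (intro powr_mono2) auto
    then show ?thesis using p by (simp add: powr_powr)
  qed
  \<comment> \<open>The coefficients are bounded by \<open>S powr (2 / p)\<close>. As
    \<open>W j \<le> 1\<close> and \<open>p / 2 \<ge> 1\<close>, the power
    \<open>W j powr (p / 2)\<close> may be replaced by \<open>W j\<close>, which is linear in the
    weights and allows the sums over segments and blocks to be exchanged.\<close>
  have VW: "V j powr (p / 2) \<le> S * W j" if "j \<in> {1..n}" for j
  proof -
    have "V j \<le> (\<Sum>k | k \<in> K \<and> meets k j. S powr (2 / p) * w k)"
      unfolding V_def using ew[OF that] a_le e0 by (intro sum_mono mult_mono) auto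
    also have "\<dots> = S powr (2 / p) * W j" by (simp add: W_def sum_distrib_left)
    finally have "V j powr (p / 2) \<le> (S powr (2 / p) * W j) powr (p / 2)"
      using p V0 by (intro powr_mono2) auto
    also have "\<dots> = S * W j powr (p / 2)"
      using p S by (simp add: powr_mult powr_powr)
    also have "\<dots> \<le> S * W j"
    proof (rule mult_left_mono[OF _ S])
      have W0: "0 \<le> W j" unfolding W_def by (intro sum_nonneg w0)
      have "W j \<le> (\<Sum>k | k \<in> K \<and> meets k j. (1 / 2) ^ Suc k)"
        unfolding W_def by (intro sum_mono w1)
      also have "\<dots> \<le> (\<Sum>k\<in>K. (1 / 2) ^ Suc k)" using K by (intro sum_mono2) auto
      also have "\<dots> \<le> 1" by (rule sum_half_powers_le[OF K])
      finally have "W j powr (p / 2) \<le> W j powr 1" using W0 p by (intro powr_mono') auto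
      then show "W j powr (p / 2) \<le> W j" using W0 by simp
    qed
    finally show ?thesis .
  qed
  \<comment> \<open>Disjoint segments have different least points, and here these lie below
    \<open>b k\<close>.\<close>
  have card_meets: "real (card {j\<in>{1..n}. meets k j}) \<le> real (b k)" for k
  proof -
    have "inj_on (\<lambda>j. Min (s j \<inter> {..<b k})) {j\<in>{1..n}. meets k j}"
    proof (rule inj_onI)
      fix i j assume ij: "i \<in> {j\<in>{1..n}. meets k j}" "j \<in> {j\<in>{1..n}. meets k j}"
        and eq: "Min (s i \<inter> {..<b k}) = Min (s j \<inter> {..<b k})"
      have "Min (s l \<inter> {..<b k}) \<in> s l" if "meets k l" for l
        using that Min_in[of "s l \<inter> {..<b k}"] by (auto simp: meets_def)
      then have "s i \<inter> s j \<noteq> {}" using ij eq by force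
      then show "i = j" using ds ij unfolding disjoint_segments_def disjoint_family_on_def by blast
    qed
    moreover have "(\<lambda>j. Min (s j \<inter> {..<b k})) ` {j\<in>{1..n}. meets k j} \<subseteq> {..<b k}"
    proof
      fix v assume "v \<in> (\<lambda>j. Min (s j \<inter> {..<b k})) ` {j\<in>{1..n}. meets k j}"
      then obtain j where "meets k j" "v = Min (s j \<inter> {..<b k})" by blast
      then show "v \<in> {..<b k}" using Min_in[of "s j \<inter> {..<b k}"] by (auto simp: meets_def)
    qed
    ultimately have "card {j\<in>{1..n}. meets k j} \<le> card {..<b k}" by (rule card_inj_on_le) simp
    then show ?thesis by simp
  qed
  have "(\<Sum>j=1..n. W j) = (\<Sum>j=1..n. \<Sum>k\<in>K. if meets k j then w k else 0)"
    unfolding W_def using K by (simp add: sum.inter_filter)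
  also have "\<dots> = (\<Sum>k\<in>K. \<Sum>j=1..n. if meets k j then w k else 0)" by (rule sum.swap)
  also have "\<dots> = (\<Sum>k\<in>K. real (card {j\<in>{1..n}. meets k j}) * w k)"
    by (simp flip: sum.inter_filter)
  also have "\<dots> \<le> (\<Sum>k\<in>K. (1 / 2) ^ Suc k)"
  proof (rule sum_mono)
    fix k
    have "real (card {j\<in>{1..n}. meets k j}) * w k \<le> (real (b k) + 1) * w k"
      using card_meets[of k] w0 by (intro mult_right_mono) auto
    also have "(real (b k) + 1) * w k = (1 / 2) ^ Suc k"
    proof -
      have "real (b k) + 1 \<noteq> 0" by linarith
      then show ?thesis unfolding w_def by (metis nonzero_mult_div_cancel_left times_divide_eq_right)
    qed
    finally show "real (card {j\<in>{1..n}. meets k j}) * w k \<le> (1 / 2) ^ Suc k" .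
  qed
  also have "\<dots> \<le> 1" by (rule sum_half_powers_le[OF K])
  finally have "S * (\<Sum>j=1..n. W j) \<le> S * 1" by (rule mult_left_mono) (rule S)
  moreover have "(\<Sum>j=1..n. V j powr (p / 2)) \<le> (\<Sum>j=1..n. S * W j)" using VW by (intro sum_mono)
  ultimately have VS: "(\<Sum>j=1..n. V j powr (p / 2)) \<le> S" by (simp add: sum_distrib_left)

  have "(\<Sum>j=1..n. energy (\<lambda>i. \<Sum>k\<in>K. a k * x k i) (s j) powr (p / 2)) \<le>
      (\<Sum>j=1..n. 2 powr (p / 2) * (U j powr (p / 2) + V j powr (p / 2)))"
    unfolding split using U0 V0 p by (intro sum_mono powr_add_le) auto
  also have "\<dots> = 2 powr (p / 2) * ((\<Sum>j=1..n. U j powr (p / 2)) + (\<Sum>j=1..n. V j powr (p / 2)))"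
    by (simp add: sum_distrib_left sum.distrib distrib_left)
  also have "\<dots> \<le> 2 powr (p / 2) * (2 * S)" using US VS by (intro mult_left_mono) auto
  finally show "(\<Sum>j=1..n. energy (\<lambda>i. \<Sum>k\<in>K. a k * x k i) (s j) powr (p / 2)) \<le>
      2 powr (p / 2) * (2 * (\<Sum>k\<in>K. \<bar>a k\<bar> powr p))" by (simp add: S_def)
qed

end

subsection \<open>Heavy paths\<close>

text \<open>Tychonoff's theorem, to be applied to characteristic functions of sets of pairs (number
  of a path, point of the tree).\<close>

lemma compact_UNIV_bool_fun: "compact (UNIV :: ('i \<Rightarrow> bool) set)"
proof -
  have "compact (UNIV :: bool set)" by (rule finite_imp_compact) simp
  then have "compact_space (product_topology (\<lambda>_::'i. euclidean :: bool topology) UNIV)"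
    by (subst compact_space_product_topology) (simp add: compact_space_def)
  then show ?thesis by (simp add: euclidean_product_topology compact_space_def)
qed

lemma open_coordinate_eq: "open {d :: 'i \<Rightarrow> bool. d j = v}"
proof -
  have "open ((\<lambda>d :: 'i \<Rightarrow> bool. d j) -` {v})"
    by (rule open_vimage) (auto intro: open_discrete)
  then show ?thesis by (simp add: vimage_def)
qed

text \<open>Zorn's lemma applies because a union of chains that are nested in each other is a
  chain.\<close>

lemma chain_in_branch:
  assumes "s \<in> Chains r"
  shows "\<exists>B. is_branch r B \<and> s \<subseteq> B"
proof -
  define \<A> where "\<A> = {C \<in> Chains r. s \<subseteq> C}"
  have "\<exists>M\<in>\<A>. \<forall>X\<in>\<A>. M \<subseteq> X \<longrightarrow> X = M"
  proof (rule subset_Zorn_nonempty)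
    show "\<A> \<noteq> {}" using assms by (auto simp: \<A>_def)
  next
    fix \<C> assume \<C>: "\<C> \<noteq> {}" "subset.chain \<A> \<C>"
    have "\<Union>\<C> \<in> Chains r"
      unfolding Chains_def
    proof (intro CollectI ballI)
      fix a b assume "a \<in> \<Union>\<C>" "b \<in> \<Union>\<C>"
      then obtain A B where AB: "A \<in> \<C>" "B \<in> \<C>" "a \<in> A" "b \<in> B" by blast
      then have "A \<subseteq> B \<or> B \<subseteq> A" using \<C>(2) by (auto simp: subset.chain_def)
      then obtain C where "C \<in> \<C>" "a \<in> C" "b \<in> C" using AB by blast
      then show "(a, b) \<in> r \<or> (b, a) \<in> r"
        using \<C>(2) by (auto simp: subset.chain_def \<A>_def Chains_def)
    qed
    moreover obtain C where "C \<in> \<C>" "s \<subseteq> C" using \<C> by (auto simp: subset.chain_def \<A>_def)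
    then have "s \<subseteq> \<Union>\<C>" by blast
    ultimately show "\<Union>\<C> \<in> \<A>" by (simp add: \<A>_def)
  qed
  then obtain B where B: "B \<in> \<A>" "\<And>X. X \<in> \<A> \<Longrightarrow> B \<subseteq> X \<Longrightarrow> X = B" by blast
  then show ?thesis by (intro exI[of _ B]) (auto simp: is_branch_def \<A>_def)
qed

lemma ex_branch: "\<exists>B. is_branch r B"
  using chain_in_branch[of "{}" r] by (auto simp: Chains_def)

context jt_tree
begin

text \<open>Two heavy paths that differ below the support of \<open>x\<close> are disjoint on it, so there are at most
  \<open>D\<close> courses; \<open>e\<close> lists end points of representatives.\<close>

lemma heavy_paths_courses:
  assumes x: "x \<in> c00" "jt_norm r p x \<le> 1" and \<theta>: "0 < \<theta>" and D: "1 \<le> real D * \<theta> powr (p / 2)"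
  shows "\<exists>e :: nat \<Rightarrow> nat. \<forall>n. \<theta> \<le> energy x (down n) \<longrightarrow>
    (\<exists>i<D. \<forall>k N. (k, n) \<in> r \<longrightarrow> k < N \<longrightarrow> (\<forall>j<N. x j = 0) \<longrightarrow> (k, e i) \<in> r)"
proof (cases "\<exists>n. x n \<noteq> 0")
  case False
  then have "energy x s = 0" for s by (simp add: energy_def)
  then show ?thesis using \<theta> by simp
next
  case True
  define m where "m = (LEAST n. x n \<noteq> 0)"
  have m: "x m \<noteq> 0" unfolding m_def by (rule LeastI_ex) (rule True)
  have m_le: "m \<le> n" if "x n \<noteq> 0" for n unfolding m_def using that by (rule Least_le)
  define H where "H = {n. \<theta> \<le> energy x (down n)}"
  \<comment> \<open>The course of a path is its trace before \<open>m\<close>, the first point of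
    the support of \<open>x\<close>.\<close>
  define tr where "tr n = down n \<inter> {..<m}" for n
  define R where "R = tr ` H"
  define rep where "rep = inv_into H tr"
  have rep: "rep t \<in> H" "tr (rep t) = t" if "t \<in> R" for t
    using that unfolding R_def rep_def by (simp_all add: inv_into_into f_inv_into_f)
  have finR: "finite R"
    by (rule finite_subset[of _ "Pow {..<m}"]) (auto simp: R_def tr_def)
  \<comment> \<open>Paths through a common point \<open>c\<close> coincide below \<open>c\<close>.
    Hence different traces force the paths to be disjoint from \<open>m\<close> on.\<close>
  have tr_eq: "tr n = tr c" if "(c, n) \<in> r" "m \<le> c" for c n
    using that unfolding tr_def by (auto intro: r_trans r_of_le)
  have "disjoint_segments R (\<lambda>t. down (rep t) \<inter> {m..})"
    unfolding disjoint_segments_def disjoint_family_on_def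
  proof (intro conjI ballI impI finR)
    show "segment_or_empty (down (rep t) \<inter> {m..})" for t
      by (rule segment_or_empty_Int[OF down_segment]) auto
  next
    fix t t' assume t: "t \<in> R" "t' \<in> R" "t \<noteq> t'"
    show "down (rep t) \<inter> {m..} \<inter> (down (rep t') \<inter> {m..}) = {}"
    proof (rule ccontr)
      assume "down (rep t) \<inter> {m..} \<inter> (down (rep t') \<inter> {m..}) \<noteq> {}"
      then obtain c where "(c, rep t) \<in> r" "(c, rep t') \<in> r" "m \<le> c" by auto
      then have "tr (rep t) = tr (rep t')" using tr_eq by metis
      then show False using t rep by simp
    qed
  qed
  from disjoint_segments_le_norm[OF x(1) this]
  have "(\<Sum>t\<in>R. energy x (down (rep t) \<inter> {m..}) powr (p / 2)) \<le> jt_norm r p x powr p" .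
  also have "\<dots> \<le> 1 powr p" using x p jt_norm_nonneg by (intro powr_mono2) auto
  finally have le1: "(\<Sum>t\<in>R. energy x (down (rep t) \<inter> {m..}) powr (p / 2)) \<le> 1" by simp
  \<comment> \<open>Cutting at \<open>m\<close> loses no energy, so each of these disjoint segments
    still contributes \<open>\<theta> powr (p / 2)\<close> to a sum that is at most 1. This bounds
    the number of traces by \<open>D\<close>.\<close>
  have "\<theta> powr (p / 2) \<le> energy x (down (rep t) \<inter> {m..}) powr (p / 2)" if "t \<in> R" for t
  proof -
    have "energy x (down (rep t)) = energy x (down (rep t) \<inter> {m..})"
      unfolding energy_def using m_le by (intro sum.mono_neutral_right) auto
    then show ?thesis using rep[OF that] \<theta> p by (intro powr_mono2) (auto simp: H_def)
  qed
  then have "(\<Sum>t\<in>R. \<theta> powr (p / 2)) \<le> (\<Sum>t\<in>R. energy x (down (rep t) \<inter> {m..}) powr (p / 2))"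
    by (rule sum_mono)
  with le1 D have "real (card R) * \<theta> powr (p / 2) \<le> real D * \<theta> powr (p / 2)" by simp
  then have card: "card R \<le> D" using \<theta> by simp
  obtain h where h: "bij_betw h {0..<card R} R" using ex_bij_betw_nat_finite[OF finR] by blast
  show ?thesis
  proof (intro exI[of _ "rep \<circ> h"] allI impI)
    fix n assume "\<theta> \<le> energy x (down n)"
    then have n: "tr n \<in> R" by (simp add: R_def H_def)
    then have "tr n \<in> h ` {0..<card R}" using h by (simp add: bij_betw_def)
    then obtain i where i: "i < card R" "h i = tr n" by force
    \<comment> \<open>A nonzero \<open>x\<close> vanishes below \<open>N\<close> only if
      \<open>N \<le> m\<close>, so one list of end points, independent of \<open>N\<close>, serves
      all such \<open>N\<close>.\<close>
    have "(k, rep (h i)) \<in> r" if "(k, n) \<in> r" "k < N" "\<forall>j<N. x j = 0" for k N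
    proof -
      have "N \<le> m" using m that(3) by (meson not_le)
      then have "k \<in> tr (rep (tr n))" using that rep(2)[OF n] by (simp add: tr_def)
      then show ?thesis by (simp add: i tr_def)
    qed
    then show "\<exists>i<D. \<forall>k N. (k, n) \<in> r \<longrightarrow> k < N \<longrightarrow> (\<forall>j<N. x j = 0) \<longrightarrow> (k, (rep \<circ> h) i) \<in> r"
      using i card by (intro exI[of _ i]) auto
  qed
qed

text \<open>\<open>Q\<close> will mean closeness to the subspace; the compactness argument treats it
  as an arbitrary predicate. The norm on \<open>T\<close> is squared to be comparable with energies,
  and strictness will contradict an energy of at least \<open>\<theta>\<close>.\<close>

definition flat_vectors :: "real \<Rightarrow> ((nat \<Rightarrow> real) \<Rightarrow> bool) \<Rightarrow> nat set \<Rightarrow> nat \<Rightarrow> (nat \<Rightarrow> real) set" where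
  "flat_vectors \<theta> Q T N = {x \<in> c00. (\<forall>n<N. x n = 0) \<and> jt_norm r p x = 1 \<and>
     (jt_norm r p (restrict_seq T x))\<^sup>2 < \<theta> \<and> Q x}"

text \<open>This yields the finite intersection property: finitely many requirements follow from the
  one with all their branches and the largest starting point.\<close>

lemma flat_vectors_antimono:
  assumes "T \<subseteq> T'" "N \<le> N'"
  shows "flat_vectors \<theta> Q T' N' \<subseteq> flat_vectors \<theta> Q T N"
proof
  fix x assume x: "x \<in> flat_vectors \<theta> Q T' N'"
  then have "jt_norm r p (restrict_seq T x) \<le> jt_norm r p (restrict_seq T' x)"
    using assms by (intro jt_norm_mono c00_restrict) (auto simp: flat_vectors_def restrict_seq_def)
  then have "(jt_norm r p (restrict_seq T x))\<^sup>2 \<le> (jt_norm r p (restrict_seq T' x))\<^sup>2"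
    using x by (intro power_mono jt_norm_nonneg) (auto simp: flat_vectors_def)
  then show "x \<in> flat_vectors \<theta> Q T N" using x assms by (auto simp: flat_vectors_def)
qed

text \<open>The end points of the courses of \<open>heavy_paths_courses\<close> define down-sets, and these
  accumulate along the flat vectors at \<open>D\<close> chains, by compactness of \<open>{0,1}\<close>-valued functions.\<close>

lemma heavy_paths_in_branches:
  assumes \<theta>: "0 < \<theta>"
    and flat: "\<And>\<T> N. finite \<T> \<Longrightarrow> \<forall>\<tau>\<in>\<T>. is_branch r \<tau> \<Longrightarrow> flat_vectors \<theta> Q (\<Union>\<T>) N \<noteq> {}"
  shows "\<exists>T. \<forall>N. \<exists>x \<in> flat_vectors \<theta> Q T N.
    \<forall>s. is_segment r s \<longrightarrow> \<theta> \<le> energy x s \<longrightarrow> s \<inter> {..<N} \<subseteq> T"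
proof -
  obtain D :: nat where "1 / \<theta> powr (p / 2) \<le> real D" using real_arch_simple by blast
  then have D: "1 \<le> real D * \<theta> powr (p / 2)" using \<theta> by (simp add: divide_le_eq)
  define V where "V = {x \<in> c00. jt_norm r p x = 1}"
  have "\<forall>x\<in>V. \<exists>e :: nat \<Rightarrow> nat. \<forall>n. \<theta> \<le> energy x (down n) \<longrightarrow>
    (\<exists>i<D. \<forall>k N. (k, n) \<in> r \<longrightarrow> k < N \<longrightarrow> (\<forall>j<N. x j = 0) \<longrightarrow> (k, e i) \<in> r)"
    using heavy_paths_courses[OF _ _ \<theta> D] by (simp add: V_def)
  from bchoice[OF this] obtain e :: "(nat \<Rightarrow> real) \<Rightarrow> nat \<Rightarrow> nat" where
    e: "\<forall>x\<in>V. \<forall>n. \<theta> \<le> energy x (down n) \<longrightarrow>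
      (\<exists>i<D. \<forall>k N. (k, n) \<in> r \<longrightarrow> k < N \<longrightarrow> (\<forall>j<N. x j = 0) \<longrightarrow> (k, e x i) \<in> r)"
    by (elim exE) (rule that)
  \<comment> \<open>A list of paths becomes one point of a compact space; the slice of
    \<open>f x\<close> at \<open>i\<close> is the down-set of \<open>e x i\<close>.\<close>
  define f where "f x = (\<lambda>(i, n). (n, e x i) \<in> r)" for x
  define I where "I = {(\<T>, N :: nat). finite \<T> \<and> (\<forall>\<tau>\<in>\<T>. is_branch r \<tau>)}"
  define F where "F = (\<lambda>(\<T>, N). f ` flat_vectors \<theta> Q (\<Union>\<T>) N)"
  have "UNIV \<inter> (\<Inter>i\<in>I. closure (F i)) \<noteq> {}"
  proof (rule compact_imp_fip_image)
    show "compact (UNIV :: (nat \<times> nat \<Rightarrow> bool) set)" by (rule compact_UNIV_bool_fun)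
  next
    fix I' assume I': "finite I'" "I' \<subseteq> I"
    define \<T> where "\<T> = \<Union>(fst ` I')"
    define N where "N = Max (insert 0 (snd ` I'))"
    have "finite \<T>" "\<forall>\<tau>\<in>\<T>. is_branch r \<tau>" using I' by (auto simp: \<T>_def I_def)
    then obtain x where x: "x \<in> flat_vectors \<theta> Q (\<Union>\<T>) N" using flat by blast
    have "f x \<in> F i" if "i \<in> I'" for i
    proof -
      have "\<Union>(fst i) \<subseteq> \<Union>\<T>" unfolding \<T>_def using that by blast
      moreover have "snd i \<le> N" unfolding N_def using that I' by (intro Max_ge) auto
      ultimately have "x \<in> flat_vectors \<theta> Q (\<Union>(fst i)) (snd i)"
        using x flat_vectors_antimono[of "\<Union>(fst i)" "\<Union>\<T>" "snd i" N \<theta> Q] by blast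
      then show ?thesis by (auto simp: F_def split: prod.splits)
    qed
    then have "f x \<in> (\<Inter>i\<in>I'. closure (F i))" using closure_subset by blast
    then show "UNIV \<inter> (\<Inter>i\<in>I'. closure (F i)) \<noteq> {}" by blast
  qed simp
  then obtain c where c: "\<And>i. i \<in> I \<Longrightarrow> c \<in> closure (F i)" by blast
  have near: "\<exists>x \<in> flat_vectors \<theta> Q (\<Union>\<T>) N. f x \<in> U"
    if "finite \<T>" "\<forall>\<tau>\<in>\<T>. is_branch r \<tau>" "open U" "c \<in> U" for \<T> N U
  proof -
    have "c \<in> closure (F (\<T>, N))" using that by (intro c) (auto simp: I_def)
    then have "F (\<T>, N) \<inter> U \<noteq> {}" using that closure_iff_nhds_not_empty by blast
    then show ?thesis by (auto simp: F_def)
  qed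
  \<comment> \<open>Being a chain is a condition on two points at a time, and two points in a slice
    of \<open>c\<close> lie in the same slice of some \<open>f x\<close>, which is a chain.\<close>
  have "{n. c (i, n)} \<in> Chains r" for i
    unfolding Chains_def
  proof (intro CollectI ballI)
    fix a b assume ab: "a \<in> {n. c (i, n)}" "b \<in> {n. c (i, n)}"
    have "\<exists>x \<in> flat_vectors \<theta> Q (\<Union>{}) 0. f x \<in> {d. d (i, a) = True} \<inter> {d. d (i, b) = True}"
      using ab by (intro near open_Int open_coordinate_eq) auto
    then obtain x where "(a, e x i) \<in> r" "(b, e x i) \<in> r" by (auto simp: f_def)
    then show "(a, b) \<in> r \<or> (b, a) \<in> r" by (rule r_comparable)
  qed
  then have "\<forall>i. \<exists>B. is_branch r B \<and> {n. c (i, n)} \<subseteq> B" using chain_in_branch by blast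
  then obtain \<tau> where \<tau>: "\<And>i. is_branch r (\<tau> i)" "\<And>i. {n. c (i, n)} \<subseteq> \<tau> i" by metis
  show ?thesis
  proof (intro exI[of _ "\<Union>(\<tau> ` {..<D})"] allI)
    fix N
    \<comment> \<open>\<open>U\<close> fixes which points below \<open>N\<close> belong to the first
      \<open>D\<close> paths. Now \<open>near\<close> is used with the branches that come from
      \<open>c\<close> itself, so \<open>x\<close> is flat on them and its heavy paths follow them
      below \<open>N\<close>.\<close>
    define U where "U = (\<Inter>j\<in>{..<D} \<times> {..<N}. {d. d j = c j})"
    have "open U" unfolding U_def by (intro open_INT) (auto intro: open_coordinate_eq)
    then obtain x where x: "x \<in> flat_vectors \<theta> Q (\<Union>(\<tau> ` {..<D})) N" and fx: "f x \<in> U"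
      using near[of "\<tau> ` {..<D}" U N] \<tau> by (auto simp: U_def)
    have xV: "x \<in> V" and x0: "\<forall>j<N. x j = 0" using x by (auto simp: V_def flat_vectors_def)
    have "s \<inter> {..<N} \<subseteq> \<Union>(\<tau> ` {..<D})" if s: "is_segment r s" "\<theta> \<le> energy x s" for s
    proof -
      obtain n where n: "s \<subseteq> down n" using segment_in_down s by blast
      then have "\<theta> \<le> energy x (down n)" using s energy_mono[OF finite_down n, of x] by simp
      then obtain i where i: "i < D" "\<And>k. (k, n) \<in> r \<Longrightarrow> k < N \<Longrightarrow> (k, e x i) \<in> r"
        using e[rule_format, OF xV] x0 by blast
      have "k \<in> \<tau> i" if "k \<in> s" "k < N" for k
      proof -
        have "f x (i, k)" using i that n by (auto simp: f_def)
        moreover have "f x (i, k) = c (i, k)" using fx i(1) that by (auto simp: U_def)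
        ultimately show ?thesis using \<tau> by blast
      qed
      then show ?thesis using i(1) by auto
    qed
    then show "\<exists>x\<in>flat_vectors \<theta> Q (\<Union>(\<tau> ` {..<D})) N.
        \<forall>s. is_segment r s \<longrightarrow> \<theta> \<le> energy x s \<longrightarrow> s \<inter> {..<N} \<subseteq> \<Union>(\<tau> ` {..<D})"
      using x by blast
  qed
qed

end

text \<open>The choice is recursive: each vector starts beyond the support of its predecessor, and
  \<open>P\<close> may refer to this start \<open>b j\<close>, which is unknown before the
  predecessor is chosen.\<close>

lemma blocks_choice:
  assumes "\<And>j N. \<exists>x\<in>c00. (\<forall>n<N. x n = 0) \<and> P j N x"
  shows "\<exists>b x. blocks b x \<and> (\<forall>j::nat. P j (b j) (x j))"
proof -
  define v where "v j N = (SOME x. x \<in> c00 \<and> (\<forall>n<N. x n = 0) \<and> P j N x)" for j N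
  have v: "v j N \<in> c00 \<and> (\<forall>n<N. v j N n = 0) \<and> P j N (v j N)" for j N
  proof -
    have "\<exists>x. x \<in> c00 \<and> (\<forall>n<N. x n = 0) \<and> P j N x" using assms by blast
    from someI_ex[OF this] show ?thesis unfolding v_def .
  qed
  then have vc: "v j N \<in> c00" and v0: "n < N \<Longrightarrow> v j N n = 0" and P: "P j N (v j N)" for j N n
    by auto
  have "\<forall>j N. \<exists>M. \<forall>n\<ge>M. v j N n = 0" using c00_bounded vc by blast
  then obtain M where M: "\<And>j N n. M j N \<le> n \<Longrightarrow> v j N n = 0" by metis
  define b where "b = rec_nat 0 (\<lambda>j n. max n (M j n))"
  \<comment> \<open>The maximum keeps \<open>b\<close> monotone even when the bound
    \<open>M j (b j)\<close> lies below the start.\<close>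
  have bS: "b (Suc j) = max (b j) (M j (b j))" for j by (simp add: b_def)
  have "blocks b (\<lambda>j. v j (b j))"
    unfolding blocks_def
  proof (intro conjI allI impI)
    show "mono b" by (rule incseq_SucI) (simp add: bS)
    show "v j (b j) \<in> c00" for j by (rule vc)
    show "b j \<le> k" if "v j (b j) k \<noteq> 0" for j k
      using that v0[of k "b j" j] by (auto simp: not_less[symmetric])
    show "k < b (Suc j)" if "v j (b j) k \<noteq> 0" for j k
      using that M[of j "b j" k] by (auto simp: bS not_le[symmetric])
  qed
  then show ?thesis using P by blast
qed

text \<open>A segment that is heavy for \<open>x j\<close> stays in \<open>T\<close> before
  \<open>b j\<close>. There the support of an earlier \<open>x i\<close> lies, and
  \<open>x i\<close> is flat on \<open>T\<close>, so the segment is not heavy for it.\<close>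

lemma (in jt_tree) blocks_heavy_once:
  assumes \<theta>: "0 < \<theta>"
    and flat: "\<And>\<T> N. finite \<T> \<Longrightarrow> \<forall>\<tau>\<in>\<T>. is_branch r \<tau> \<Longrightarrow> flat_vectors \<theta> Q (\<Union>\<T>) N \<noteq> {}"
  shows "\<exists>b x. blocks b x \<and> (\<forall>j. jt_norm r p (x j) = 1 \<and> Q (x j) \<and> (\<forall>n<N. x j n = 0)) \<and>
    (\<forall>s i j. is_segment r s \<longrightarrow> \<theta> \<le> energy (x i) s \<longrightarrow> \<theta> \<le> energy (x j) s \<longrightarrow> i = j)"
proof -
  obtain T where T: "\<And>N. \<exists>x \<in> flat_vectors \<theta> Q T N.
      \<forall>s. is_segment r s \<longrightarrow> \<theta> \<le> energy x s \<longrightarrow> s \<inter> {..<N} \<subseteq> T"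
    using heavy_paths_in_branches[OF \<theta> flat] by blast
  have "\<exists>x\<in>c00. (\<forall>n<N'. x n = 0) \<and> (x \<in> flat_vectors \<theta> Q T (max N N') \<and>
      (\<forall>s. is_segment r s \<longrightarrow> \<theta> \<le> energy x s \<longrightarrow> s \<inter> {..<N'} \<subseteq> T))" for N' :: nat
  proof -
    obtain x where x: "x \<in> flat_vectors \<theta> Q T (max N N')"
      and s: "\<And>s. is_segment r s \<Longrightarrow> \<theta> \<le> energy x s \<Longrightarrow> s \<inter> {..<max N N'} \<subseteq> T"
      using T[of "max N N'"] by blast
    have "s \<inter> {..<N'} \<subseteq> T" if "is_segment r s" "\<theta> \<le> energy x s" for s
      using s[OF that] by auto
    then show ?thesis using x by (intro bexI[of _ x]) (auto simp: flat_vectors_def)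
  qed
  from blocks_choice[where P = "\<lambda>_ N' x. x \<in> flat_vectors \<theta> Q T (max N N') \<and>
      (\<forall>s. is_segment r s \<longrightarrow> \<theta> \<le> energy x s \<longrightarrow> s \<inter> {..<N'} \<subseteq> T)", OF this]
  obtain b x where bl: "blocks b x" and x: "\<And>j. x j \<in> flat_vectors \<theta> Q T (max N (b j))"
    and heavy: "\<And>j s. is_segment r s \<Longrightarrow> \<theta> \<le> energy (x j) s \<Longrightarrow> s \<inter> {..<b j} \<subseteq> T"
    by blast
  have less: False if ij: "i < j" and s: "is_segment r s" "\<theta> \<le> energy (x i) s" "\<theta> \<le> energy (x j) s" for i j s
  proof -
    have bij: "b (Suc i) \<le> b j" using ij bl by (auto simp: blocks_def intro: monoD)
    have sT: "s \<inter> {..<b j} \<subseteq> T" using s by (intro heavy)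
    have "x i k = restrict_seq T (x i) k" if "k \<in> s" for k
    proof (cases "x i k = 0")
      case False
      then have "k < b j" using bl bij unfolding blocks_def by (meson order_less_le_trans)
      then show ?thesis using sT that by (auto simp: restrict_seq_def)
    qed (simp add: restrict_seq_def)
    then have "energy (x i) s = energy (restrict_seq T (x i)) s" by (rule energy_cong)
    also have "\<dots> \<le> (jt_norm r p (restrict_seq T (x i)))\<^sup>2"
      using bl s by (intro segment_energy_le_norm c00_restrict) (auto simp: blocks_def)
    also have "\<dots> < \<theta>" using x[of i] by (simp add: flat_vectors_def)
    finally show False using s by simp
  qed
  have "i = j" if "is_segment r s" "\<theta> \<le> energy (x i) s" "\<theta> \<le> energy (x j) s" for s i j
    using less[of i j s] less[of j i s] that by (cases i j rule: linorder_cases) auto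
  moreover have "\<forall>j. jt_norm r p (x j) = 1 \<and> Q (x j) \<and> (\<forall>n<N. x j n = 0)"
    using x by (auto simp: flat_vectors_def)
  ultimately show ?thesis using bl by blast
qed

subsection \<open>Subspaces isomorphic to \<open>\<ell>\<^sub>p\<close>\<close>

lemma lp_space_scale:
  assumes "a \<in> lp_space p" shows "(\<lambda>k. t * a k) \<in> lp_space p"
  using assms summable_mult[of "\<lambda>k. \<bar>a k\<bar> powr p" "\<bar>t\<bar> powr p"]
  by (simp add: lp_space_def abs_mult powr_mult)

lemma lp_space_add:
  assumes "a \<in> lp_space p" "b \<in> lp_space p" "0 \<le> p"
  shows "(\<lambda>k. a k + b k) \<in> lp_space p"
proof -
  have sum: "summable (\<lambda>k. 2 powr p * (\<bar>a k\<bar> powr p + \<bar>b k\<bar> powr p))"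
    using assms by (intro summable_mult summable_add) (auto simp: lp_space_def)
  have "\<bar>a k + b k\<bar> powr p \<le> 2 powr p * (\<bar>a k\<bar> powr p + \<bar>b k\<bar> powr p)" for k
  proof -
    have "\<bar>a k + b k\<bar> powr p \<le> (\<bar>a k\<bar> + \<bar>b k\<bar>) powr p"
      using assms by (intro powr_mono2) auto
    also have "\<dots> \<le> 2 powr p * (\<bar>a k\<bar> powr p + \<bar>b k\<bar> powr p)"
      using assms by (intro powr_add_le) auto
    finally show ?thesis .
  qed
  then show ?thesis
    unfolding lp_space_def by (auto intro!: summable_comparison_test'[OF sum, of 0])
qed

lemma lp_space_diff:
  assumes "a \<in> lp_space p" "b \<in> lp_space p" "0 \<le> p"
  shows "(\<lambda>k. a k - b k) \<in> lp_space p"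
  using lp_space_add[OF assms(1) lp_space_scale[OF assms(2), of "-1"] assms(3)] by simp

lemma sum_powr_le_lp_norm:
  assumes "a \<in> lp_space p" "finite K" "0 < p"
  shows "(\<Sum>k\<in>K. \<bar>a k\<bar> powr p) powr (1 / p) \<le> lp_norm p a"
  unfolding lp_norm_def using assms
  by (intro powr_mono2 sum_le_suminf) (auto simp: lp_space_def intro: sum_nonneg)

lemma coord_le_lp_norm:
  assumes "a \<in> lp_space p" "0 < p"
  shows "\<bar>a k\<bar> \<le> lp_norm p a"
  using sum_powr_le_lp_norm[OF assms(1), of "{k}"] assms(2) by (simp add: powr_powr)

lemma lp_norm_leI:
  assumes "0 < p" "0 \<le> B" and le: "\<And>n. (\<Sum>k<n. \<bar>a k\<bar> powr p) \<le> B powr p"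
  shows "a \<in> lp_space p" "lp_norm p a \<le> B"
proof -
  have s: "summable (\<lambda>k. \<bar>a k\<bar> powr p)" by (rule summableI_nonneg_bounded[OF _ le]) auto
  then show "a \<in> lp_space p" by (simp add: lp_space_def)
  have "lp_norm p a \<le> (B powr p) powr (1 / p)"
    unfolding lp_norm_def using assms s by (intro powr_mono2 suminf_le_const suminf_nonneg) auto
  then show "lp_norm p a \<le> B" using assms by (simp add: powr_powr)
qed

text \<open>The upper estimate on arbitrary finite sets gives convergence, and both estimates pass
  to the limit. The image is closed because the lower estimate turns Cauchy images into Cauchy
  preimages; the completeness of \<open>\<ell>\<^sub>p\<close> is proved along the way, by
  coordinatewise limits.\<close>

lemma lp_embedding:
  fixes y :: "nat \<Rightarrow> 'a::banach"
  assumes p: "0 < p" and c: "0 < c" and C: "0 \<le> C"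
    and lower: "\<And>a n. c * (\<Sum>k<n. \<bar>a k\<bar> powr p) powr (1 / p) \<le> norm (\<Sum>k<n. a k *\<^sub>R y k)"
    and upper: "\<And>a K. finite K \<Longrightarrow>
      norm (\<Sum>k\<in>K. a k *\<^sub>R y k) \<le> C * (\<Sum>k\<in>K. \<bar>a k\<bar> powr p) powr (1 / p)"
    and Y: "subspace Y" "closed Y" and y: "\<And>k. y k \<in> Y"
  shows "\<exists>Z. closed_subspace_of Z Y \<and> isomorphic_to_lp p Z"
proof -
  define T where "T a = (\<Sum>k. a k *\<^sub>R y k)" for a
  have summ: "summable (\<lambda>k. a k *\<^sub>R y k)" if a: "a \<in> lp_space p" for a
    unfolding summable_Cauchy
  proof (intro allI impI)
    fix e :: real assume e: "0 < e"
    \<comment> \<open>Chosen so that \<open>C * d powr (1 / p) = C * e / (C + 1) < e\<close>; the 1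
      also covers \<open>C = 0\<close>.\<close>
    define d where "d = (e / (C + 1)) powr p"
    have "0 < d" using e C by (simp add: d_def)
    then obtain N where N: "\<And>m n. N \<le> m \<Longrightarrow> norm (\<Sum>k=m..<n. \<bar>a k\<bar> powr p) < d"
      using a unfolding lp_space_def summable_Cauchy by blast
    have "norm (\<Sum>k=m..<n. a k *\<^sub>R y k) < e" if "N \<le> m" for m n
    proof -
      have "(\<Sum>k=m..<n. \<bar>a k\<bar> powr p) powr (1 / p) \<le> d powr (1 / p)"
        using N[OF that, of n] p by (intro powr_mono2) (auto intro: sum_nonneg)
      also have "\<dots> = e / (C + 1)" using e C p by (simp add: d_def powr_powr)
      finally have "C * (\<Sum>k=m..<n. \<bar>a k\<bar> powr p) powr (1 / p) \<le> C * (e / (C + 1))"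
        using C by (rule mult_left_mono)
      also have "\<dots> < e" using C e by (simp add: field_simps)
      finally show ?thesis using upper[of "{m..<n}" a] by simp
    qed
    then show "\<exists>N. \<forall>m\<ge>N. \<forall>n. norm (\<Sum>k=m..<n. a k *\<^sub>R y k) < e" by blast
  qed
  then have lim: "(\<lambda>n. \<Sum>k<n. a k *\<^sub>R y k) \<longlonglongrightarrow> T a" if "a \<in> lp_space p" for a
    unfolding T_def using that by (intro summable_LIMSEQ)
  have T_upper: "norm (T a) \<le> C * lp_norm p a" if a: "a \<in> lp_space p" for a
  proof (rule tendsto_upperbound[OF tendsto_norm[OF lim[OF a]]])
    have "norm (\<Sum>k<n. a k *\<^sub>R y k) \<le> C * lp_norm p a" for n
      using upper[of "{..<n}" a] mult_left_mono[OF sum_powr_le_lp_norm[OF a _ p] C, of "{..<n}"]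
      by simp
    then show "\<forall>\<^sub>F n in sequentially. norm (\<Sum>k<n. a k *\<^sub>R y k) \<le> C * lp_norm p a" by simp
  qed simp
  have T_lower: "c * lp_norm p a \<le> norm (T a)" if a: "a \<in> lp_space p" for a
  proof (rule tendsto_le[OF _ tendsto_norm[OF lim[OF a]]])
    have "(\<lambda>n. \<Sum>k<n. \<bar>a k\<bar> powr p) \<longlonglongrightarrow> (\<Sum>k. \<bar>a k\<bar> powr p)"
      using a by (intro summable_LIMSEQ) (simp add: lp_space_def)
    then show "(\<lambda>n. c * (\<Sum>k<n. \<bar>a k\<bar> powr p) powr (1 / p)) \<longlonglongrightarrow> c * lp_norm p a"
      unfolding lp_norm_def using p
      by (intro tendsto_mult tendsto_const tendsto_powr') (auto intro!: always_eventually sum_nonneg)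
  qed (use lower in auto)
  have T_add: "T (\<lambda>k. a k + b k) = T a + T b" if "a \<in> lp_space p" "b \<in> lp_space p" for a b
    unfolding T_def using suminf_add[OF summ[OF that(1)] summ[OF that(2)]] by (simp add: scaleR_add_left)
  have T_scale: "T (\<lambda>k. t * a k) = t *\<^sub>R T a" if "a \<in> lp_space p" for a t
    unfolding T_def using suminf_scaleR_right[OF summ[OF that], of t] by simp
  have T_diff: "T (\<lambda>k. a k - b k) = T a - T b" if "a \<in> lp_space p" "b \<in> lp_space p" for a b
    using T_add[OF that(1) lp_space_scale[OF that(2), of "-1"]] T_scale[OF that(2), of "-1"] by simp
  have T_lin: "linear_seq_on (lp_space p) T"
    unfolding linear_seq_on_def using T_add T_scale by blast
  have zero: "(\<lambda>_. 0) \<in> lp_space p" by (simp add: lp_space_def)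
  have sub: "subspace (T ` lp_space p)"
    unfolding subspace_def
  proof (intro conjI ballI allI)
    show "0 \<in> T ` lp_space p" using zero by (intro image_eqI[of _ _ "\<lambda>_. 0"]) (simp_all add: T_def)
  next
    fix u v assume "u \<in> T ` lp_space p" "v \<in> T ` lp_space p"
    then obtain a b where "u = T a" "v = T b" "a \<in> lp_space p" "b \<in> lp_space p" by blast
    then show "u + v \<in> T ` lp_space p"
      using T_add[of a b] lp_space_add[of a p b] p by (metis image_eqI less_imp_le)
  next
    fix t u assume "u \<in> T ` lp_space p"
    then obtain a where "u = T a" "a \<in> lp_space p" by blast
    then show "t *\<^sub>R u \<in> T ` lp_space p" using T_scale[of a t] lp_space_scale[of a p t] by (metis image_eqI)
  qed
  have "T ` lp_space p \<subseteq> Y"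
  proof
    fix u assume "u \<in> T ` lp_space p"
    then obtain a where a: "u = T a" "a \<in> lp_space p" by blast
    have "(\<Sum>k<n. a k *\<^sub>R y k) \<in> Y" for n
      using Y y by (intro subspace_sum subspace_scale)
    then show "u \<in> Y" using closed_sequentially[OF Y(2) _ lim[OF a(2)]] a(1) by simp
  qed
  moreover have "closed (T ` lp_space p)"
    unfolding closed_sequential_limits
  proof (intro allI impI, elim conjE)
    fix z l assume z: "\<forall>n. z n \<in> T ` lp_space p" and zl: "z \<longlonglongrightarrow> l"
    then have "\<forall>n. \<exists>a. a \<in> lp_space p \<and> z n = T a" by blast
    then obtain a where a: "\<And>n. a n \<in> lp_space p" "\<And>n. z n = T (a n)" by metis
    have diff: "(\<lambda>k. a m k - a n k) \<in> lp_space p" for m n using a p by (intro lp_space_diff) auto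
    have bound: "lp_norm p (\<lambda>k. a m k - a n k) \<le> norm (z m - z n) / c" for m n
      using T_lower[OF diff] T_diff[OF a(1) a(1)] c by (simp add: a(2) le_divide_eq mult.commute)
    have zC: "Cauchy z" using zl by (rule LIMSEQ_imp_Cauchy)
    have "Cauchy (\<lambda>n. a n k)" for k
      unfolding Cauchy_def
    proof (intro allI impI)
      fix e :: real assume "0 < e"
      then obtain M where M: "\<And>m n. M \<le> m \<Longrightarrow> M \<le> n \<Longrightarrow> dist (z m) (z n) < e * c"
        using zC c unfolding Cauchy_def by (metis mult_pos_pos)
      have "dist (a m k) (a n k) < e" if "M \<le> m" "M \<le> n" for m n
      proof -
        have "\<bar>a m k - a n k\<bar> \<le> norm (z m - z n) / c"
          using coord_le_lp_norm[OF diff[of m n] p, of k] bound[of m n] by simp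
        also have "\<dots> < e" using M[OF that] c by (simp add: dist_norm divide_less_eq)
        finally show ?thesis by (simp add: dist_norm)
      qed
      then show "\<exists>M. \<forall>m\<ge>M. \<forall>n\<ge>M. dist (a m k) (a n k) < e" by blast
    qed
    then have "\<forall>k. \<exists>L. (\<lambda>n. a n k) \<longlonglongrightarrow> L" using Cauchy_convergent convergent_def by blast
    then obtain \<alpha> where \<alpha>: "\<And>k. (\<lambda>n. a n k) \<longlonglongrightarrow> \<alpha> k" by metis
    \<comment> \<open>As in Fatou's lemma, a bound on finite sums survives the coordinatewise limit
      in \<open>m\<close>.\<close>
    have tail: "(\<lambda>k. \<alpha> k - a n k) \<in> lp_space p \<and> lp_norm p (\<lambda>k. \<alpha> k - a n k) \<le> e"
      if "0 < e" "\<And>m. M \<le> m \<Longrightarrow> norm (z m - z n) / c \<le> e" for e n M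
    proof -
      have "(\<Sum>k<K. \<bar>\<alpha> k - a n k\<bar> powr p) \<le> e powr p" for K
      proof (rule tendsto_upperbound)
        show "(\<lambda>m. \<Sum>k<K. \<bar>a m k - a n k\<bar> powr p) \<longlonglongrightarrow> (\<Sum>k<K. \<bar>\<alpha> k - a n k\<bar> powr p)"
          using \<alpha> p by (intro tendsto_sum tendsto_powr' tendsto_rabs tendsto_diff tendsto_const) auto
        have "(\<Sum>k<K. \<bar>a m k - a n k\<bar> powr p) \<le> e powr p" if "M \<le> m" for m
        proof -
          have "(\<Sum>k<K. \<bar>a m k - a n k\<bar> powr p) powr (1 / p) \<le> e"
            using sum_powr_le_lp_norm[OF diff[of m n] _ p, of "{..<K}"] bound[of m n]
              \<open>\<And>m. M \<le> m \<Longrightarrow> norm (z m - z n) / c \<le> e\<close>[OF that] by simp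
          then have "((\<Sum>k<K. \<bar>a m k - a n k\<bar> powr p) powr (1 / p)) powr p \<le> e powr p"
            using p by (intro powr_mono2) auto
          then show ?thesis using p by (simp add: powr_powr sum_nonneg)
        qed
        then show "\<forall>\<^sub>F m in sequentially. (\<Sum>k<K. \<bar>a m k - a n k\<bar> powr p) \<le> e powr p"
          by (auto simp: eventually_sequentially)
      qed simp
      then show ?thesis using lp_norm_leI[of p e "\<lambda>k. \<alpha> k - a n k"] p that(1) by simp
    qed
    have ev: "\<exists>M. \<forall>n\<ge>M. (\<lambda>k. \<alpha> k - a n k) \<in> lp_space p \<and> lp_norm p (\<lambda>k. \<alpha> k - a n k) \<le> e"
      if e: "0 < e" for e
    proof -
      obtain M where M: "\<And>m n. M \<le> m \<Longrightarrow> M \<le> n \<Longrightarrow> dist (z m) (z n) < e * c"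
        using zC c e unfolding Cauchy_def by (metis mult_pos_pos)
      have "norm (z m - z n) / c \<le> e" if "M \<le> m" "M \<le> n" for m n
        using M[OF that] c by (simp add: dist_norm divide_le_eq)
      then show ?thesis using tail[OF e] by blast
    qed
    have "\<alpha> \<in> lp_space p"
    proof -
      obtain n where "(\<lambda>k. \<alpha> k - a n k) \<in> lp_space p" using ev[of 1] by auto
      from lp_space_add[OF this a(1)[of n]] p show ?thesis by simp
    qed
    then have "T \<alpha> \<in> T ` lp_space p" by blast
    moreover have "z \<longlonglongrightarrow> T \<alpha>"
    proof (rule LIMSEQ_I)
      fix e :: real assume e: "0 < e"
      then have "0 < e / (C + 1)" using C by simp
      from ev[OF this] obtain M where M: "\<And>n. M \<le> n \<Longrightarrow> (\<lambda>k. \<alpha> k - a n k) \<in> lp_space p"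
        "\<And>n. M \<le> n \<Longrightarrow> lp_norm p (\<lambda>k. \<alpha> k - a n k) \<le> e / (C + 1)" by blast
      have "norm (z n - T \<alpha>) < e" if "M \<le> n" for n
      proof -
        have "norm (T \<alpha> - z n) \<le> C * lp_norm p (\<lambda>k. \<alpha> k - a n k)"
          using T_upper[OF M(1)[OF that]] T_diff[OF \<open>\<alpha> \<in> lp_space p\<close> a(1)] by (simp add: a(2))
        also have "\<dots> \<le> C * (e / (C + 1))" using M(2)[OF that] C by (rule mult_left_mono)
        also have "\<dots> < e" using C e by (simp add: field_simps)
        finally show ?thesis by (simp add: norm_minus_commute)
      qed
      then show "\<exists>M. \<forall>n\<ge>M. norm (z n - T \<alpha>) < e" by blast
    qed
    ultimately show "l \<in> T ` lp_space p" using zl LIMSEQ_unique by blast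
  qed
  ultimately have "closed_subspace_of (T ` lp_space p) Y" using sub by (simp add: closed_subspace_of_def)
  moreover have "isomorphic_to_lp p (T ` lp_space p)"
    unfolding isomorphic_to_lp_def using T_lin T_upper T_lower c by blast
  ultimately show ?thesis by blast
qed

subsection \<open>The completion\<close>

locale jt_completion = jt_tree r p for r p +
  fixes J :: "(nat \<Rightarrow> real) \<Rightarrow> 'a::banach"
  assumes J: "jt_isometry r p J"
begin

abbreviation basis :: "nat \<Rightarrow> 'a" where
  "basis n \<equiv> J (unit_seq n)"

lemma J_add: "x \<in> c00 \<Longrightarrow> y \<in> c00 \<Longrightarrow> J (\<lambda>n. x n + y n) = J x + J y"
  using J by (simp add: jt_isometry_def linear_seq_on_def)

lemma J_scale: "x \<in> c00 \<Longrightarrow> J (\<lambda>n. t * x n) = t *\<^sub>R J x"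
  using J by (simp add: jt_isometry_def linear_seq_on_def)

lemma J_norm: "x \<in> c00 \<Longrightarrow> norm (J x) = jt_norm r p x"
  using J by (simp add: jt_isometry_def)

lemma J_diff: "x \<in> c00 \<Longrightarrow> y \<in> c00 \<Longrightarrow> J (\<lambda>n. x n - y n) = J x - J y"
  using J_add[of x "\<lambda>n. -1 * y n"] J_scale[of y "-1"] c00_scale[of y "-1"] by simp

lemma J_zero: "J (\<lambda>_. 0) = 0"
  using J_scale[of "\<lambda>_. 0" 0] by (simp add: c00_def)

lemma J_sum:
  assumes "finite I" "\<And>i. i \<in> I \<Longrightarrow> x i \<in> c00"
  shows "J (\<lambda>n. \<Sum>i\<in>I. x i n) = (\<Sum>i\<in>I. J (x i))"
  using assms
proof (induction I rule: finite_induct)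
  case empty
  then show ?case by (simp add: J_zero)
next
  case (insert i I)
  then show ?case using J_add[of "x i" "\<lambda>n. \<Sum>i\<in>I. x i n"] c00_sum[of I x] by simp
qed

lemma jt_norm_scale: "x \<in> c00 \<Longrightarrow> jt_norm r p (\<lambda>n. t * x n) = \<bar>t\<bar> * jt_norm r p x"
  using J_scale[of x t] J_norm[of x] J_norm[of "\<lambda>n. t * x n"] c00_scale[of x t] by simp

lemma restrict_seq_finite_c00: "finite F \<Longrightarrow> restrict_seq F x \<in> c00"
  unfolding c00_def restrict_seq_def by (auto intro: finite_subset[of _ F])

lemma J_restrict_finite:
  assumes "finite F"
  shows "J (restrict_seq F x) = (\<Sum>n\<in>F. x n *\<^sub>R basis n)"
proof -
  have u: "unit_seq n \<in> c00" for n by (simp add: c00_def unit_seq_def)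
  have "restrict_seq F x = (\<lambda>k. \<Sum>n\<in>F. x n * unit_seq n k)"
  proof
    fix k
    have "(\<Sum>n\<in>F. x n * unit_seq n k) = (\<Sum>n\<in>F. if n = k then x n else 0)"
      by (rule sum.cong) (auto simp: unit_seq_def)
    also have "\<dots> = restrict_seq F x k" using assms by (simp add: sum.delta restrict_seq_def)
    finally show "restrict_seq F x k = (\<Sum>n\<in>F. x n * unit_seq n k)" by simp
  qed
  then show ?thesis using J_sum[OF assms, of "\<lambda>n k. x n * unit_seq n k"] u c00_scale J_scale by simp
qed

lemma norm_sum_basis_mono:
  assumes "finite F'" "F \<subseteq> F'"
  shows "norm (\<Sum>n\<in>F. x n *\<^sub>R basis n) \<le> norm (\<Sum>n\<in>F'. x n *\<^sub>R basis n)"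
proof -
  have "finite F" using assms finite_subset by blast
  then have "jt_norm r p (restrict_seq F x) \<le> jt_norm r p (restrict_seq F' x)"
    using assms by (intro jt_norm_mono restrict_seq_finite_c00) (auto simp: restrict_seq_def)
  then show ?thesis
    using assms \<open>finite F\<close> by (simp add: restrict_seq_finite_c00 J_norm flip: J_restrict_finite)
qed

lemma coord_le_norm_sum_basis:
  assumes "finite F" "k \<in> F"
  shows "\<bar>x k\<bar> \<le> norm (\<Sum>n\<in>F. x n *\<^sub>R basis n)"
proof -
  have "\<bar>restrict_seq F x k\<bar> \<le> norm (J (restrict_seq F x))"
    using coord_le_norm J_norm restrict_seq_finite_c00[OF assms(1)] by metis
  then show ?thesis using assms by (simp add: J_restrict_finite) (simp add: restrict_seq_def)
qed

text \<open>Applied to the difference of two expansions of one vector, this makes the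
  \<open>THE\<close> in \<open>jt_coord\<close> well determined.\<close>

lemma coord_le_norm_sums:
  assumes "(\<lambda>n. c n *\<^sub>R basis n) sums x"
  shows "\<bar>c k\<bar> \<le> norm x"
proof (rule tendsto_lowerbound[OF tendsto_norm[OF assms[unfolded sums_def]]])
  show "\<forall>\<^sub>F n in sequentially. \<bar>c k\<bar> \<le> norm (\<Sum>n<n. c n *\<^sub>R basis n)"
    using eventually_gt_at_top[of k]
    by (rule eventually_mono) (auto intro: coord_le_norm_sum_basis)
qed simp

lemma coord_unique:
  assumes "(\<lambda>n. c n *\<^sub>R basis n) sums x" "(\<lambda>n. d n *\<^sub>R basis n) sums x"
  shows "c = d"
proof
  fix k
  have "(\<lambda>n. (c n - d n) *\<^sub>R basis n) sums 0"
    using sums_diff[OF assms] by (simp add: scaleR_diff_left)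
  from coord_le_norm_sums[OF this, of k] show "c k = d k" by simp
qed

lemma jt_coord_eq: "(\<lambda>n. c n *\<^sub>R basis n) sums x \<Longrightarrow> jt_coord J x = c"
  unfolding jt_coord_def using coord_unique by (intro the_equality) auto

text \<open>The coordinates are limits of those of finitely supported approximations. The series
  converges to \<open>x\<close> because truncation is a contraction, whatever its length, and fixes
  a finitely supported vector once it is long enough.\<close>

lemma ex_coord:
  assumes "x \<in> jt_space J"
  shows "\<exists>c. (\<lambda>n. c n *\<^sub>R basis n) sums x"
proof -
  obtain v where v: "\<And>i. v i \<in> c00" and vx: "(\<lambda>i. J (v i)) \<longlonglongrightarrow> x"
  proof -
    obtain u where "\<forall>i. u i \<in> J ` c00" "u \<longlonglongrightarrow> x"
      using assms unfolding jt_space_def closure_sequential by blast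
    moreover from this(1) have "\<forall>i. \<exists>w. w \<in> c00 \<and> u i = J w" by blast
    then obtain v where "\<forall>i. v i \<in> c00 \<and> u i = J (v i)" by metis
    moreover from this have "u = (\<lambda>i. J (v i))" by auto
    ultimately show ?thesis using that[of v] by auto
  qed
  have cauchy: "Cauchy (\<lambda>i. J (v i))" using vx by (rule LIMSEQ_imp_Cauchy)
  have restr: "norm (J (restrict_seq F (\<lambda>n. v i n - v j n))) \<le> dist (J (v i)) (J (v j))" for F i j
  proof -
    have d: "(\<lambda>n. v i n - v j n) \<in> c00" using v by auto
    have "norm (J (restrict_seq F (\<lambda>n. v i n - v j n))) \<le> norm (J (\<lambda>n. v i n - v j n))"
      using d unfolding J_norm[OF d] J_norm[OF c00_restrict[OF d]]
      by (intro jt_norm_mono c00_restrict) (auto simp: restrict_seq_def)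
    then show ?thesis using v by (simp add: J_diff dist_norm)
  qed
  have coord: "\<bar>v i n - v j n\<bar> \<le> dist (J (v i)) (J (v j))" for i j n
  proof -
    have "(\<lambda>n. v i n - v j n) \<in> c00" using v by auto
    from coord_le_norm[OF this, of n] J_norm[OF this] show ?thesis
      using v by (simp add: J_diff dist_norm)
  qed
  have "Cauchy (\<lambda>i. v i n)" for n
    unfolding Cauchy_def
  proof (intro allI impI)
    fix e :: real assume "0 < e"
    then obtain M where "\<forall>i\<ge>M. \<forall>j\<ge>M. dist (J (v i)) (J (v j)) < e"
      using cauchy unfolding Cauchy_def by blast
    then show "\<exists>M. \<forall>i\<ge>M. \<forall>j\<ge>M. dist (v i n) (v j n) < e"
      using coord unfolding dist_real_def by (meson order_le_less_trans)
  qed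
  then have "\<forall>n. \<exists>L. (\<lambda>i. v i n) \<longlonglongrightarrow> L" using Cauchy_convergent convergent_def by blast
  then obtain c where c: "\<And>n. (\<lambda>i. v i n) \<longlonglongrightarrow> c n" by metis
  have "(\<lambda>N. \<Sum>n<N. c n *\<^sub>R basis n) \<longlonglongrightarrow> x"
  proof (rule LIMSEQ_I)
    fix e :: real assume e: "0 < e"
    obtain M1 where M1: "\<And>i j. M1 \<le> i \<Longrightarrow> M1 \<le> j \<Longrightarrow> dist (J (v i)) (J (v j)) < e / 3"
      using cauchy e unfolding Cauchy_def by (metis divide_pos_pos zero_less_numeral)
    obtain M2 where M2: "\<And>i. M2 \<le> i \<Longrightarrow> norm (J (v i) - x) < e / 3"
      using LIMSEQ_D[OF vx, of "e / 3"] e by auto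
    define i where "i = max M1 M2"
    obtain M where M: "\<And>n. M \<le> n \<Longrightarrow> v i n = 0" using c00_bounded[OF v] by blast
    have "norm ((\<Sum>n<N. c n *\<^sub>R basis n) - x) < e" if N: "M \<le> N" for N
    proof -
      have lim: "(\<lambda>j. norm (\<Sum>n<N. (v j n - v i n) *\<^sub>R basis n)) \<longlonglongrightarrow>
          norm (\<Sum>n<N. (c n - v i n) *\<^sub>R basis n)"
        using c by (intro tendsto_intros)
      have "norm (\<Sum>n<N. (c n - v i n) *\<^sub>R basis n) \<le> e / 3"
      proof (rule tendsto_upperbound[OF lim])
        have "norm (\<Sum>n<N. (v j n - v i n) *\<^sub>R basis n) \<le> e / 3" if "M1 \<le> j" for j
          using restr[of "{..<N}" j i] M1[of j i] that by (simp add: J_restrict_finite i_def)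
        then show "\<forall>\<^sub>F j in sequentially. norm (\<Sum>n<N. (v j n - v i n) *\<^sub>R basis n) \<le> e / 3"
          by (auto simp: eventually_sequentially)
      qed simp
      moreover have "J (v i) = (\<Sum>n<N. v i n *\<^sub>R basis n)"
      proof -
        have "v i n = 0" if "\<not> n < N" for n using M[of n] N that by linarith
        then have "v i = restrict_seq {..<N} (v i)" by (auto simp: restrict_seq_def)
        then show ?thesis using J_restrict_finite[of "{..<N}" "v i"] by simp
      qed
      ultimately have "norm ((\<Sum>n<N. c n *\<^sub>R basis n) - J (v i)) \<le> e / 3"
        by (simp add: scaleR_diff_left sum_subtractf)
      moreover have "norm (J (v i) - x) < e / 3" by (rule M2) (simp add: i_def)
      ultimately show ?thesis
        using norm_triangle_ineq[of "(\<Sum>n<N. c n *\<^sub>R basis n) - J (v i)" "J (v i) - x"] e by simp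
    qed
    then show "\<exists>M. \<forall>N\<ge>M. norm ((\<Sum>n<N. c n *\<^sub>R basis n) - x) < e" by blast
  qed
  then show ?thesis unfolding sums_def by blast
qed

lemma coord_sums: "x \<in> jt_space J \<Longrightarrow> (\<lambda>n. jt_coord J x n *\<^sub>R basis n) sums x"
  using ex_coord[of x] jt_coord_eq by blast

lemma jt_coord_le_norm: "x \<in> jt_space J \<Longrightarrow> \<bar>jt_coord J x n\<bar> \<le> norm x"
  by (rule coord_le_norm_sums[OF coord_sums])

lemma jt_coord_add:
  assumes "x \<in> jt_space J" "y \<in> jt_space J"
  shows "jt_coord J (x + y) n = jt_coord J x n + jt_coord J y n"
proof -
  have "(\<lambda>n. (jt_coord J x n + jt_coord J y n) *\<^sub>R basis n) sums (x + y)"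
    using sums_add[OF coord_sums[OF assms(1)] coord_sums[OF assms(2)]] by (simp add: scaleR_add_left)
  then show ?thesis by (simp add: jt_coord_eq)
qed

lemma jt_coord_scale:
  assumes "x \<in> jt_space J"
  shows "jt_coord J (t *\<^sub>R x) n = t * jt_coord J x n"
proof -
  have "(\<lambda>n. (t * jt_coord J x n) *\<^sub>R basis n) sums (t *\<^sub>R x)"
    using sums_scaleR_right[OF coord_sums[OF assms], of t] by simp
  then show ?thesis by (simp add: jt_coord_eq)
qed

text \<open>By unconditionality the tails of the restricted series are dominated by those of the
  full expansion, for any set \<open>A\<close>.\<close>

lemma jt_restrict_sums:
  assumes "x \<in> jt_space J"
  shows "(\<lambda>n. if n \<in> A then jt_coord J x n *\<^sub>R basis n else 0) sums jt_restrict J A x"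
proof -
  define c where "c = jt_coord J x"
  have part: "(\<Sum>n\<in>F. if n \<in> A then c n *\<^sub>R basis n else 0) = (\<Sum>n\<in>F \<inter> A. c n *\<^sub>R basis n)"
    if "finite F" for F using that by (simp add: sum.inter_restrict)
  have "summable (\<lambda>n. if n \<in> A then c n *\<^sub>R basis n else 0)"
    unfolding summable_Cauchy
  proof (intro allI impI)
    fix e :: real assume "0 < e"
    then obtain N where "\<And>m n. N \<le> m \<Longrightarrow> norm (\<Sum>k=m..<n. c k *\<^sub>R basis k) < e"
      using sums_summable[OF coord_sums[OF assms]] unfolding summable_Cauchy c_def by blast
    moreover have "norm (\<Sum>k=m..<n. if k \<in> A then c k *\<^sub>R basis k else 0) \<le>
        norm (\<Sum>k=m..<n. c k *\<^sub>R basis k)" for m n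
      using norm_sum_basis_mono[of "{m..<n}" "{m..<n} \<inter> A" c] by (simp add: part)
    ultimately show "\<exists>N. \<forall>m\<ge>N. \<forall>n. norm (\<Sum>k=m..<n. if k \<in> A then c k *\<^sub>R basis k else 0) < e"
      by (meson order_le_less_trans)
  qed
  then show ?thesis unfolding jt_restrict_def c_def by (rule summable_sums)
qed

lemma jt_restrict_partial:
  assumes "x \<in> jt_space J"
  shows "(\<lambda>N. J (restrict_seq A (restrict_seq {..<N} (jt_coord J x)))) \<longlonglongrightarrow> jt_restrict J A x"
proof -
  have "J (restrict_seq A (restrict_seq {..<N} (jt_coord J x))) =
      (\<Sum>n<N. if n \<in> A then jt_coord J x n *\<^sub>R basis n else 0)" for N
  proof -
    have "restrict_seq A (restrict_seq {..<N} (jt_coord J x)) = restrict_seq ({..<N} \<inter> A) (jt_coord J x)"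
      by (auto simp: restrict_seq_def)
    then show ?thesis by (simp add: J_restrict_finite sum.inter_restrict)
  qed
  then show ?thesis using jt_restrict_sums[OF assms, of A] by (simp add: sums_def)
qed

lemma partial_lim: "x \<in> jt_space J \<Longrightarrow> (\<lambda>N. J (restrict_seq {..<N} (jt_coord J x))) \<longlonglongrightarrow> x"
  using coord_sums[of x] by (simp add: sums_def J_restrict_finite)

lemma norm_jt_restrict_le:
  assumes "x \<in> jt_space J"
  shows "norm (jt_restrict J A x) \<le> norm x"
proof (rule tendsto_le[OF _ tendsto_norm[OF partial_lim[OF assms]] tendsto_norm[OF jt_restrict_partial[OF assms]]])
  have "norm (J (restrict_seq A (restrict_seq {..<N} (jt_coord J x)))) \<le>
      norm (J (restrict_seq {..<N} (jt_coord J x)))" for N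
    unfolding J_norm[OF c00_restrict_lessThan] J_norm[OF c00_restrict[OF c00_restrict_lessThan]]
    by (intro jt_norm_mono c00_restrict c00_restrict_lessThan) (auto simp: restrict_seq_def)
  then show "\<forall>\<^sub>F N in sequentially. norm (J (restrict_seq A (restrict_seq {..<N} (jt_coord J x)))) \<le>
      norm (J (restrict_seq {..<N} (jt_coord J x)))" by simp
qed simp

lemma jt_restrict_add:
  assumes "x \<in> jt_space J" "y \<in> jt_space J"
  shows "jt_restrict J A (x + y) = jt_restrict J A x + jt_restrict J A y"
proof -
  have "(\<lambda>n. if n \<in> A then jt_coord J (x + y) n *\<^sub>R basis n else 0) =
      (\<lambda>n. (if n \<in> A then jt_coord J x n *\<^sub>R basis n else 0) + (if n \<in> A then jt_coord J y n *\<^sub>R basis n else 0))"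
    by (auto simp: jt_coord_add assms scaleR_add_left)
  then show ?thesis
    using sums_unique[OF sums_add[OF jt_restrict_sums[OF assms(1), of A] jt_restrict_sums[OF assms(2), of A]]]
    by (simp add: jt_restrict_def[of J A "x + y"])
qed

lemma jt_restrict_scale:
  assumes "x \<in> jt_space J"
  shows "jt_restrict J A (t *\<^sub>R x) = t *\<^sub>R jt_restrict J A x"
proof -
  have "(\<lambda>n. if n \<in> A then jt_coord J (t *\<^sub>R x) n *\<^sub>R basis n else 0) =
      (\<lambda>n. t *\<^sub>R (if n \<in> A then jt_coord J x n *\<^sub>R basis n else 0))"
    by (auto simp: jt_coord_scale assms)
  then show ?thesis
    using sums_unique[OF sums_scaleR_right[OF jt_restrict_sums[OF assms, of A], of t]]
    by (simp add: jt_restrict_def[of J A "t *\<^sub>R x"])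
qed

section \<open>Finite-codimensional subspaces of vectors that start far out\<close>

definition kernel_below :: "'a set \<Rightarrow> nat \<Rightarrow> 'a set" where
  "kernel_below Y N = {y \<in> Y. \<forall>n<N. jt_coord J y n = 0}"

lemma closed_subspace_kernel_below:
  assumes Y: "closed_subspace_of Y (jt_space J)"
  shows "closed_subspace_of (kernel_below Y N) Y"
proof -
  have YJ: "y \<in> jt_space J" if "y \<in> Y" for y using Y that by (auto simp: closed_subspace_of_def)
  have sY: "subspace Y" and cY: "closed Y" using Y by (auto simp: closed_subspace_of_def)
  have "jt_coord J 0 n = 0" for n using jt_coord_scale[OF YJ[OF subspace_0[OF sY]], of 0] by simp
  then have "subspace (kernel_below Y N)"
    unfolding subspace_def kernel_below_def
    using sY YJ by (auto simp: subspace_0 subspace_add subspace_scale jt_coord_add jt_coord_scale)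
  moreover have "closed (kernel_below Y N)"
    unfolding closed_sequential_limits
  proof (intro allI impI, elim conjE)
    fix y l assume y: "\<forall>i. y i \<in> kernel_below Y N" and l: "y \<longlonglongrightarrow> l"
    have yY: "y i \<in> Y" for i using y by (simp add: kernel_below_def)
    have lY: "l \<in> Y" using closed_sequentially[OF cY _ l] yY by blast
    have "jt_coord J l n = 0" if "n < N" for n
    proof -
      have "\<bar>jt_coord J l n\<bar> \<le> norm (l - y i)" for i
      proof -
        have "l - y i \<in> Y" using sY lY yY by (rule subspace_diff)
        have "jt_coord J (l - y i + y i) n = jt_coord J (l - y i) n + jt_coord J (y i) n"
          using YJ[OF \<open>l - y i \<in> Y\<close>] YJ[OF yY] by (rule jt_coord_add)
        moreover have "jt_coord J (y i) n = 0" using y that by (simp add: kernel_below_def)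
        ultimately show ?thesis using jt_coord_le_norm[OF YJ[OF \<open>l - y i \<in> Y\<close>], of n] by simp
      qed
      moreover have "(\<lambda>i. norm (l - y i)) \<longlonglongrightarrow> norm (l - l)"
        using l by (intro tendsto_intros)
      ultimately have "\<bar>jt_coord J l n\<bar> \<le> 0" by (intro LIMSEQ_le_const) auto
      then show ?thesis by simp
    qed
    then show "l \<in> kernel_below Y N" using lY by (simp add: kernel_below_def)
  qed
  ultimately show ?thesis by (auto simp: closed_subspace_of_def kernel_below_def)
qed

text \<open>Each further coordinate costs at most one dimension: a vector on which this coordinate
  does not vanish, if there is one, spans a complement.\<close>

lemma finite_codim_kernel_below:
  assumes Y: "closed_subspace_of Y (jt_space J)"
  shows "finite_codim_in (kernel_below Y N) Y"
proof (induction N)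
  case 0
  have "span Y = Y" using Y by (simp add: closed_subspace_of_def span_eq_iff)
  then show ?case unfolding finite_codim_in_def kernel_below_def by (intro exI[of _ "{}"]) simp
next
  case (Suc N)
  then obtain F where F: "finite F" "F \<subseteq> Y" "span (kernel_below Y N \<union> F) = Y"
    unfolding finite_codim_in_def by blast
  have sub: "subspace (kernel_below Y N)" "kernel_below Y N \<subseteq> jt_space J"
    using closed_subspace_kernel_below[OF Y] Y by (auto simp: closed_subspace_of_def)
  obtain v where v: "v \<in> kernel_below Y N"
    and kv: "kernel_below Y N \<subseteq> span (kernel_below Y (Suc N) \<union> {v})"
  proof (cases "\<exists>v\<in>kernel_below Y N. jt_coord J v N \<noteq> 0")
    case True
    then obtain v where v: "v \<in> kernel_below Y N" "jt_coord J v N \<noteq> 0" by blast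
    have "u \<in> span (kernel_below Y (Suc N) \<union> {v})" if u: "u \<in> kernel_below Y N" for u
    proof -
      define t where "t = jt_coord J u N / jt_coord J v N"
      have mem: "u + (- t) *\<^sub>R v \<in> kernel_below Y N"
        using sub(1) u v(1) by (intro subspace_add subspace_scale)
      have "jt_coord J (u + (- t) *\<^sub>R v) N = jt_coord J u N + jt_coord J ((- t) *\<^sub>R v) N"
        using subsetD[OF sub(2)] subspace_scale[OF sub(1)] u v(1) by (intro jt_coord_add) blast+
      also have "\<dots> = 0" using sub v by (simp add: jt_coord_scale subsetD[OF sub(2)] t_def del: scaleR_minus_left)
      finally have "u + (- t) *\<^sub>R v \<in> kernel_below Y (Suc N)"
        using mem by (auto simp: kernel_below_def less_Suc_eq)
      then have "(u + (- t) *\<^sub>R v) + t *\<^sub>R v \<in> span (kernel_below Y (Suc N) \<union> {v})"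
        by (intro span_add span_scale span_base) auto
      then show ?thesis by simp
    qed
    then show ?thesis using that v(1) by blast
  next
    case False
    then have "kernel_below Y N \<subseteq> kernel_below Y (Suc N)" by (auto simp: kernel_below_def less_Suc_eq)
    \<comment> \<open>No dimension is lost in this case, and 0 takes the place of the added
      vector.\<close>
    then have "kernel_below Y N \<subseteq> span (kernel_below Y (Suc N) \<union> {0})" using span_superset by blast
    then show ?thesis using that subspace_0[OF sub(1)] by blast
  qed
  have vY: "insert v F \<subseteq> Y" using v F by (auto simp: kernel_below_def)
  have KY: "kernel_below Y (Suc N) \<subseteq> Y" by (auto simp: kernel_below_def)
  have "span (kernel_below Y (Suc N) \<union> insert v F) = Y"
  proof
    show "span (kernel_below Y (Suc N) \<union> insert v F) \<subseteq> Y"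
      using vY KY Y by (intro span_minimal) (auto simp: closed_subspace_of_def)
    have "span (kernel_below Y (Suc N) \<union> {v}) \<subseteq> span (kernel_below Y (Suc N) \<union> insert v F)"
      by (rule span_mono) auto
    then have "kernel_below Y N \<union> F \<subseteq> span (kernel_below Y (Suc N) \<union> insert v F)"
      using kv by (auto intro: span_base)
    then have "span (kernel_below Y N \<union> F) \<subseteq> span (kernel_below Y (Suc N) \<union> insert v F)"
      by (intro span_minimal) auto
    then show "Y \<subseteq> span (kernel_below Y (Suc N) \<union> insert v F)" using F by simp
  qed
  then show ?case unfolding finite_codim_in_def using F vY by (intro exI[of _ "insert v F"]) auto
qed

section \<open>Flat vectors, spread vectors and the copy of \<open>\<ell>\<^sub>p\<close>\<close>

lemma flat_vectors_if_not_isomorphism: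
  assumes Y: "closed_subspace_of Y (jt_space J)"
    and not_iso: "\<not> isomorphism_onto_image_on (kernel_below Y N) (jt_restrict J T)"
    and \<theta>: "0 < \<theta>" and \<eta>: "0 < \<eta>"
  shows "flat_vectors \<theta> (\<lambda>x. \<exists>y\<in>Y. norm (J x - y) < \<eta>) T N \<noteq> {}"
proof -
  have KJ: "y \<in> jt_space J" if "y \<in> kernel_below Y N" for y
    using Y that by (auto simp: closed_subspace_of_def kernel_below_def)
  \<comment> \<open>The truncation of \<open>y\<close> will have norm above
    \<open>norm y / 2\<close>, so normalising it turns errors below
    \<open>\<epsilon> * norm y\<close> into errors below \<open>2 * \<epsilon>\<close>. These must
    respect both \<open>\<eta>\<close> and \<open>sqrt \<theta>\<close>, the root because flatness
    bounds a square.\<close>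
  define \<epsilon> where "\<epsilon> = min \<eta> (sqrt \<theta>) / 2"
  have \<epsilon>: "0 < \<epsilon>" "2 * \<epsilon> \<le> \<eta>" "2 * \<epsilon> \<le> sqrt \<theta>" using \<theta> \<eta> by (auto simp: \<epsilon>_def)
  obtain y where yK: "y \<in> kernel_below Y N" and y: "norm (jt_restrict J T y) < \<epsilon> * norm y"
  proof -
    \<comment> \<open>Restriction is linear and contractive on the whole space, so only the lower
      bound can fail.\<close>
    have "\<not> (\<forall>y\<in>kernel_below Y N. \<epsilon> * norm y \<le> norm (jt_restrict J T y))"
    proof
      assume "\<forall>y\<in>kernel_below Y N. \<epsilon> * norm y \<le> norm (jt_restrict J T y)"
      moreover have "\<forall>y\<in>kernel_below Y N. norm (jt_restrict J T y) \<le> 1 * norm y"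
        using KJ norm_jt_restrict_le by simp
      ultimately have "isomorphism_onto_image_on (kernel_below Y N) (jt_restrict J T)"
        unfolding isomorphism_onto_image_on_def using KJ jt_restrict_add jt_restrict_scale \<epsilon>(1) by blast
      then show False using not_iso by blast
    qed
    then show ?thesis using that by force
  qed
  have yJ: "y \<in> jt_space J" by (rule KJ[OF yK])
  have y0: "0 < norm y"
  proof (rule ccontr)
    assume "\<not> 0 < norm y"
    then show False using y by simp
  qed
  define x where "x M = restrict_seq {..<M} (jt_coord J y)" for M
  have xc: "x M \<in> c00" for M by (auto simp: x_def)
  have l1: "(\<lambda>M. J (x M)) \<longlonglongrightarrow> y" unfolding x_def by (rule partial_lim[OF yJ])
  have "\<forall>\<^sub>F M in sequentially. norm (J (x M)) > norm y / 2"
    using y0 by (intro order_tendstoD(1)[OF tendsto_norm[OF l1]]) simp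
  moreover have "\<forall>\<^sub>F M in sequentially. dist (J (x M)) y < \<epsilon> * norm y"
    using y0 \<epsilon> by (intro tendstoD[OF l1]) simp
  moreover have "\<forall>\<^sub>F M in sequentially. norm (J (restrict_seq T (x M))) < \<epsilon> * norm y"
    unfolding x_def by (rule order_tendstoD(2)[OF tendsto_norm[OF jt_restrict_partial[OF yJ]] y])
  ultimately have "\<forall>\<^sub>F M in sequentially. norm (J (x M)) > norm y / 2 \<and> dist (J (x M)) y < \<epsilon> * norm y
      \<and> norm (J (restrict_seq T (x M))) < \<epsilon> * norm y"
    by eventually_elim simp
  from eventually_happens'[OF sequentially_bot this]
  obtain M where M: "norm (J (x M)) > norm y / 2" "norm (J (x M) - y) < \<epsilon> * norm y"
    "norm (J (restrict_seq T (x M))) < \<epsilon> * norm y"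
    unfolding dist_norm by blast
  define t where "t = 1 / norm (J (x M))"
  have n0: "0 < norm (J (x M))" using M(1) y0 by linarith
  have t: "0 < t" using n0 by (simp add: t_def)
  have ty: "t * (\<epsilon> * norm y) \<le> 2 * \<epsilon>"
  proof -
    have "t * norm y \<le> 2" using M(1) n0 by (simp add: t_def field_simps)
    then have "\<epsilon> * (t * norm y) \<le> \<epsilon> * 2" using \<epsilon> by (intro mult_left_mono) auto
    then show ?thesis by (simp add: algebra_simps)
  qed
  define u where "u = (\<lambda>n. t * x M n)"
  have uc: "u \<in> c00" unfolding u_def using xc by auto
  have "u n = 0" if "n < N" for n
    using yK that by (simp add: u_def x_def restrict_seq_def kernel_below_def)
  moreover have "jt_norm r p u = 1"
    unfolding u_def jt_norm_scale[OF xc] J_norm[OF xc, symmetric] using n0 by (simp add: t_def)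
  moreover have "(jt_norm r p (restrict_seq T u))\<^sup>2 < \<theta>"
  proof -
    have "restrict_seq T u = (\<lambda>n. t * restrict_seq T (x M) n)" by (auto simp: u_def restrict_seq_def)
    then have "jt_norm r p (restrict_seq T u) = t * norm (J (restrict_seq T (x M)))"
      using t by (simp add: jt_norm_scale[OF c00_restrict[OF xc]] J_norm[OF c00_restrict[OF xc]])
    also have "\<dots> < t * (\<epsilon> * norm y)" using t M(3) by (rule mult_strict_left_mono[rotated])
    finally have "jt_norm r p (restrict_seq T u) < sqrt \<theta>" using ty \<epsilon> by linarith
    moreover have "0 \<le> jt_norm r p (restrict_seq T u)" using uc by (intro jt_norm_nonneg c00_restrict)
    ultimately have "(jt_norm r p (restrict_seq T u))\<^sup>2 < (sqrt \<theta>)\<^sup>2" by (intro power_strict_mono) auto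
    then show ?thesis using \<theta> by simp
  qed
  moreover have "\<exists>y\<in>Y. norm (J u - y) < \<eta>"
  proof
    show "t *\<^sub>R y \<in> Y" using yK Y by (auto simp: kernel_below_def closed_subspace_of_def subspace_scale)
    have "J u - t *\<^sub>R y = t *\<^sub>R (J (x M) - y)" unfolding u_def J_scale[OF xc] by (simp add: scaleR_diff_right)
    then have "norm (J u - t *\<^sub>R y) = t * norm (J (x M) - y)" using t by simp
    also have "\<dots> < t * (\<epsilon> * norm y)" using t M(2) by (rule mult_strict_left_mono[rotated])
    finally show "norm (J u - t *\<^sub>R y) < \<eta>" using ty \<epsilon> by linarith
  qed
  ultimately show ?thesis using uc by (auto simp: flat_vectors_def)
qed

text \<open>Averages of flat vectors have small energy on every segment, since a segment charges
  at most one of the summands, whereas the norm of the sum grows at least like \<open>m powr (1 / p)\<close>.\<close>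

lemma spread_vectors:
  assumes sY: "subspace Y"
    and flat: "\<And>\<T> N \<theta> \<eta>. finite \<T> \<Longrightarrow> \<forall>\<tau>\<in>\<T>. is_branch r \<tau> \<Longrightarrow> 0 < \<theta> \<Longrightarrow> 0 < \<eta> \<Longrightarrow>
      flat_vectors \<theta> (\<lambda>x. \<exists>y\<in>Y. norm (J x - y) < \<eta>) (\<Union>\<T>) N \<noteq> {}"
    and \<epsilon>: "0 < \<epsilon>" and \<eta>: "0 < \<eta>"
  shows "\<exists>z\<in>c00. (\<forall>n<N. z n = 0) \<and> jt_norm r p z = 1 \<and>
    (\<forall>s. is_segment r s \<longrightarrow> energy z s \<le> \<epsilon>) \<and> (\<exists>y\<in>Y. norm (J z - y) \<le> \<eta>)"
proof -
  \<comment> \<open>Then \<open>m powr (2 / p)\<close>, a lower bound for the squared norm of a sum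
    of \<open>m\<close> blocks, is at least \<open>2 / \<epsilon>\<close>; the added 1 makes
    \<open>m\<close> positive.\<close>
  obtain m :: nat where m: "(2 / \<epsilon>) powr (p / 2) + 1 \<le> real m" using real_arch_simple by blast
  have "0 \<le> (2 / \<epsilon>) powr (p / 2)" by simp
  then have m1: "1 \<le> real m" using m by linarith
  have m2: "2 / \<epsilon> \<le> real m powr (2 / p)"
  proof -
    have "((2 / \<epsilon>) powr (p / 2)) powr (2 / p) \<le> real m powr (2 / p)"
      using m p by (intro powr_mono2) auto
    then show ?thesis using p \<epsilon> by (simp add: powr_powr)
  qed
  \<comment> \<open>With threshold \<open>1 / m\<close> the light summands have total energy at most
    1 on a segment; similarly \<open>m\<close> errors below \<open>\<eta> / m\<close> add up to at
    most \<open>\<eta>\<close>.\<close>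
  have pos: "0 < 1 / real m" "0 < \<eta> / real m" using m1 \<eta> by auto
  obtain b x where bl: "blocks b x"
    and x': "\<forall>j. jt_norm r p (x j) = 1 \<and> (\<exists>y\<in>Y. norm (J (x j) - y) < \<eta> / m) \<and> (\<forall>n<N. x j n = 0)"
    and once: "\<And>s i j. is_segment r s \<Longrightarrow> 1 / m \<le> energy (x i) s \<Longrightarrow> 1 / m \<le> energy (x j) s \<Longrightarrow> i = j"
    using blocks_heavy_once[of "1 / m" "\<lambda>x. \<exists>y\<in>Y. norm (J x - y) < \<eta> / m" N, OF pos(1) flat[OF _ _ pos]]
    by blast
  have x: "jt_norm r p (x j) = 1" "\<exists>y\<in>Y. norm (J (x j) - y) < \<eta> / m" "n < N \<Longrightarrow> x j n = 0" for j n
    using x' by auto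
  have xc: "x j \<in> c00" for j using bl by (simp add: blocks_def)
  obtain y where y: "\<And>j. y j \<in> Y" "\<And>j. norm (J (x j) - y j) < \<eta> / m" using x(2) by metis
  define w where "w = (\<lambda>k. \<Sum>j<m. x j k)"
  have wc: "w \<in> c00" unfolding w_def by (rule blocks_sum_c00[OF bl]) simp
  define L where "L = jt_norm r p w"
  have L0: "0 \<le> L" unfolding L_def by (rule jt_norm_nonneg[OF wc])
  have "real m \<le> L powr p" using blocks_lower_estimate[OF bl, of m] x by (simp add: w_def L_def)
  then have "real m powr (1 / p) \<le> (L powr p) powr (1 / p)" using p by (intro powr_mono2) auto
  then have Lm: "real m powr (1 / p) \<le> L" using L0 p by (simp add: powr_powr)
  have "1 \<le> real m powr (1 / p)" using ge_one_powr_ge_zero[OF m1, of "1 / p"] p by simp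
  then have L1: "1 \<le> L" using Lm by linarith
  \<comment> \<open>The bound 2 consists of at most 1 for the single heavy summand, which has norm
    1, and at most 1 for the light ones together.\<close>
  have energy_w: "energy w s \<le> 2" if s: "is_segment r s" for s
  proof -
    have e1: "energy (x j) s \<le> 1" for j using segment_energy_le_norm[OF xc s] x(1) by (metis one_power2)
    define H where "H = {j. j < m \<and> 1 / m \<le> energy (x j) s}"
    have "finite H" by (simp add: H_def)
    then have "card H \<le> 1" using once[OF s] by (simp add: card_le_Suc0_iff_eq H_def)
    have "energy w s = (\<Sum>j<m. energy (x j) s)" unfolding w_def by (rule blocks_energy_sum[OF bl]) simp
    also have "\<dots> \<le> (\<Sum>j<m. (if j \<in> H then 1 else 0) + 1 / m)"
      using e1 by (intro sum_mono) (auto simp: H_def intro!: add_increasing2)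
    also have "\<dots> = real (card H) + 1"
    proof -
      have "{j. j < m} \<inter> H = H" by (auto simp: H_def)
      then show ?thesis using m1 by (simp add: sum.distrib sum.If_cases lessThan_def)
    qed
    finally show ?thesis using \<open>card H \<le> 1\<close> by linarith
  qed
  define z where "z = (\<lambda>n. (1 / L) * w n)"
  have zc: "z \<in> c00" unfolding z_def using wc by (rule c00_scale)
  have "z n = 0" if "n < N" for n using x(3) that by (simp add: z_def w_def)
  moreover have "jt_norm r p z = 1"
    unfolding z_def jt_norm_scale[OF wc] using L1 by (simp add: L_def)
  moreover have "energy z s \<le> \<epsilon>" if s: "is_segment r s" for s
  proof -
    have "(real m powr (1 / p))\<^sup>2 \<le> L\<^sup>2" using Lm by (intro power_mono) auto
    moreover have "(real m powr (1 / p))\<^sup>2 = real m powr (2 / p)"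
      using m1 by (simp add: powr_powr flip: powr_numeral)
    ultimately have "2 / \<epsilon> \<le> L\<^sup>2" using m2 by simp
    then have "2 / L\<^sup>2 \<le> \<epsilon>" using \<epsilon> L1 by (simp add: field_simps)
    moreover have "energy z s \<le> 2 / L\<^sup>2"
      unfolding z_def energy_scale using energy_w[OF s] by (simp add: power_divide divide_right_mono)
    ultimately show ?thesis by simp
  qed
  moreover have "\<exists>y\<in>Y. norm (J z - y) \<le> \<eta>"
  proof
    show "(1 / L) *\<^sub>R (\<Sum>j<m. y j) \<in> Y" using sY y by (intro subspace_scale subspace_sum)
    have "J z - (1 / L) *\<^sub>R (\<Sum>j<m. y j) = (1 / L) *\<^sub>R (\<Sum>j<m. J (x j) - y j)"
      unfolding z_def J_scale[OF wc] unfolding w_def by (simp add: J_sum xc scaleR_diff_right sum_subtractf)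
    then have "norm (J z - (1 / L) *\<^sub>R (\<Sum>j<m. y j)) = norm (\<Sum>j<m. J (x j) - y j) / L"
      using L1 by simp
    also have "\<dots> \<le> norm (\<Sum>j<m. J (x j) - y j)"
      using L1 by (simp add: divide_le_eq mult_le_cancel_left1)
    also have "\<dots> \<le> (\<Sum>j<m. \<eta> / m)"
      using y(2) by (intro sum_norm_le) (auto intro: less_imp_le)
    also have "\<dots> = \<eta>" using m1 by simp
    finally show "norm (J z - (1 / L) *\<^sub>R (\<Sum>j<m. y j)) \<le> \<eta>" .
  qed
  ultimately show ?thesis using zc by blast
qed

text \<open>The blocks themselves need not lie in \<open>Y\<close>; nearby vectors of
  \<open>Y\<close> inherit their two estimates by a small perturbation.\<close>

lemma lp_subspace_if_spread_vectors:
  assumes Y: "closed_subspace_of Y (jt_space J)"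
    and spread: "\<And>N \<epsilon> \<eta>. 0 < \<epsilon> \<Longrightarrow> 0 < \<eta> \<Longrightarrow> \<exists>z\<in>c00. (\<forall>n<N. z n = 0) \<and> jt_norm r p z = 1 \<and>
      (\<forall>s. is_segment r s \<longrightarrow> energy z s \<le> \<epsilon>) \<and> (\<exists>y\<in>Y. norm (J z - y) \<le> \<eta>)"
  shows "\<exists>Z. closed_subspace_of Z Y \<and> isomorphic_to_lp p Z"
proof -
  \<comment> \<open>The energy bound depends on the start \<open>N\<close> of the block, as
    \<open>blocks_upper_estimate\<close> demands, so it has to be imposed during the recursion. The
    distances to \<open>Y\<close> add up to at most 1 / 2, half of the lower constant 1 of the
    blocks.\<close>
  define P where "P j N z \<longleftrightarrow> jt_norm r p z = 1 \<and>
    (\<forall>s. is_segment r s \<longrightarrow> energy z s \<le> (1 / 2) ^ Suc j / (real N + 1)) \<and>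
    (\<exists>y\<in>Y. norm (J z - y) \<le> (1 / 2) ^ Suc j / 2)" for j N z
  have "\<exists>z\<in>c00. (\<forall>n<N. z n = 0) \<and> P j N z" for j N
    unfolding P_def by (rule spread) auto
  from blocks_choice[of P, OF this] obtain b x where bl: "blocks b x" and P: "\<And>j. P j (b j) (x j)"
    by blast
  have xc: "x j \<in> c00" for j using bl by (simp add: blocks_def)
  have norm1: "jt_norm r p (x j) = 1" for j using P[of j] by (simp add: P_def)
  have small: "energy (x j) s * (b j + 1) \<le> (1 / 2) ^ Suc j" if "is_segment r s" for j s
    using P[of j] that unfolding P_def by (simp add: le_divide_eq add.commute del: power_Suc)
  have "\<forall>j. \<exists>y. y \<in> Y \<and> norm (J (x j) - y) \<le> (1 / 2) ^ Suc j / 2"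
    using P unfolding P_def by blast
  then obtain y where y: "\<And>j. y j \<in> Y" "\<And>j. norm (J (x j) - y j) \<le> (1 / 2) ^ Suc j / 2" by metis
  define A where "A a K = (\<Sum>k\<in>K. \<bar>a k\<bar> powr p) powr (1 / p)" for a :: "nat \<Rightarrow> real" and K
  have A0: "0 \<le> A a K" for a K by (simp add: A_def)
  have coord_A: "\<bar>a k\<bar> \<le> A a K" if "finite K" "k \<in> K" for a k K
  proof -
    have "\<bar>a k\<bar> powr p \<le> (\<Sum>k\<in>K. \<bar>a k\<bar> powr p)" using that by (intro member_le_sum) auto
    then have "(\<bar>a k\<bar> powr p) powr (1 / p) \<le> A a K"
      unfolding A_def using p by (intro powr_mono2) auto
    then show ?thesis using p by (simp add: powr_powr)
  qed
  have perturb: "norm ((\<Sum>k\<in>K. a k *\<^sub>R y k) - J (\<lambda>i. \<Sum>k\<in>K. a k * x k i)) \<le> A a K / 2"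
    if K: "finite K" for a K
  proof -
    have "J (\<lambda>i. \<Sum>k\<in>K. a k * x k i) = (\<Sum>k\<in>K. a k *\<^sub>R J (x k))"
      using J_sum[OF K, of "\<lambda>k i. a k * x k i"] xc by (simp add: c00_scale J_scale)
    then have "norm ((\<Sum>k\<in>K. a k *\<^sub>R y k) - J (\<lambda>i. \<Sum>k\<in>K. a k * x k i)) =
        norm (\<Sum>k\<in>K. a k *\<^sub>R (y k - J (x k)))"
      by (simp add: scaleR_diff_right sum_subtractf)
    also have "\<dots> \<le> (\<Sum>k\<in>K. A a K * ((1 / 2) ^ Suc k / 2))"
    proof (rule sum_norm_le)
      fix k assume k: "k \<in> K"
      have "norm (a k *\<^sub>R (y k - J (x k))) = \<bar>a k\<bar> * norm (J (x k) - y k)"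
        by (simp add: norm_minus_commute)
      also have "\<dots> \<le> A a K * ((1 / 2) ^ Suc k / 2)"
        using coord_A[OF K k] y(2) A0 by (intro mult_mono) auto
      finally show "norm (a k *\<^sub>R (y k - J (x k))) \<le> A a K * ((1 / 2) ^ Suc k / 2)" .
    qed
    also have "\<dots> = A a K / 2 * (\<Sum>k\<in>K. (1 / 2) ^ Suc k)"
      by (simp add: sum_distrib_left)
    also have "\<dots> \<le> A a K / 2 * 1"
      using A0 sum_half_powers_le[OF K] by (intro mult_left_mono) auto
    finally show ?thesis by simp
  qed
  \<comment> \<open>The p-th root of the constant in \<open>blocks_upper_estimate\<close>.\<close>
  define C where "C = (2 powr (p / 2) * 2) powr (1 / p)"
  have C0: "0 \<le> C" by (simp add: C_def)
  have up: "norm (J (\<lambda>i. \<Sum>k\<in>K. a k * x k i)) \<le> C * A a K" if K: "finite K" for a K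
  proof -
    have c: "(\<lambda>i. \<Sum>k\<in>K. a k * x k i) \<in> c00" by (rule blocks_sum_c00[OF blocks_scale[OF bl] K])
    have "jt_norm r p (\<lambda>i. \<Sum>k\<in>K. a k * x k i) powr p \<le> 2 powr (p / 2) * (2 * (\<Sum>k\<in>K. \<bar>a k\<bar> powr p))"
      using norm1 small by (intro blocks_upper_estimate[OF bl K]) auto
    then have "(jt_norm r p (\<lambda>i. \<Sum>k\<in>K. a k * x k i) powr p) powr (1 / p) \<le>
        (2 powr (p / 2) * 2 * (\<Sum>k\<in>K. \<bar>a k\<bar> powr p)) powr (1 / p)"
      using p by (intro powr_mono2) (auto simp: mult.assoc)
    also have "\<dots> = C * A a K" unfolding C_def A_def by (rule powr_mult)
    finally show ?thesis using p jt_norm_nonneg[OF c] by (simp add: powr_powr J_norm[OF c])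
  qed
  have low: "A a {..<n} \<le> norm (J (\<lambda>i. \<Sum>k<n. a k * x k i))" for a n
  proof -
    have c: "(\<lambda>i. \<Sum>k<n. a k * x k i) \<in> c00" by (rule blocks_sum_c00[OF blocks_scale[OF bl]]) simp
    have "(\<Sum>k<n. \<bar>a k\<bar> powr p) \<le> jt_norm r p (\<lambda>i. \<Sum>k<n. a k * x k i) powr p"
      using blocks_lower_estimate[OF blocks_scale[OF bl, of a], of n] by (simp add: jt_norm_scale xc norm1)
    then have "A a {..<n} \<le> (jt_norm r p (\<lambda>i. \<Sum>k<n. a k * x k i) powr p) powr (1 / p)"
      unfolding A_def using p by (intro powr_mono2) (auto intro: sum_nonneg)
    then show ?thesis using p jt_norm_nonneg[OF c] by (simp add: powr_powr J_norm[OF c])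
  qed
  show ?thesis
  \<comment> \<open>The perturbation, at most \<open>A a K / 2\<close>, lowers the constant 1 to 1 /
    2 and raises \<open>C\<close> to \<open>C + 1 / 2\<close>.\<close>
  proof (rule lp_embedding[where c = "1 / 2" and C = "C + 1 / 2" and y = y])
    show "1 / 2 * (\<Sum>k<n. \<bar>a k\<bar> powr p) powr (1 / p) \<le> norm (\<Sum>k<n. a k *\<^sub>R y k)" for a n
    proof -
      have "norm (J (\<lambda>i. \<Sum>k<n. a k * x k i)) - norm (\<Sum>k<n. a k *\<^sub>R y k) \<le> A a {..<n} / 2"
        using norm_triangle_ineq2[of "J (\<lambda>i. \<Sum>k<n. a k * x k i)" "\<Sum>k<n. a k *\<^sub>R y k"]
          perturb[of "{..<n}" a] by (simp add: norm_minus_commute)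
      with low[of a n] have "A a {..<n} / 2 \<le> norm (\<Sum>k<n. a k *\<^sub>R y k)" by simp
      then show ?thesis by (simp add: A_def)
    qed
    show "norm (\<Sum>k\<in>K. a k *\<^sub>R y k) \<le> (C + 1 / 2) * (\<Sum>k\<in>K. \<bar>a k\<bar> powr p) powr (1 / p)"
      if "finite K" for a K
    proof -
      have "norm (\<Sum>k\<in>K. a k *\<^sub>R y k) - norm (J (\<lambda>i. \<Sum>k\<in>K. a k * x k i)) \<le> A a K / 2"
        using norm_triangle_ineq2[of "\<Sum>k\<in>K. a k *\<^sub>R y k" "J (\<lambda>i. \<Sum>k\<in>K. a k * x k i)"]
          perturb[OF that, of a] by simp
      with up[OF that, of a] have "norm (\<Sum>k\<in>K. a k *\<^sub>R y k) \<le> C * A a K + A a K / 2" by simp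
      then show ?thesis by (simp add: A_def distrib_right)
    qed
  qed (use p C0 Y y in \<open>auto simp: closed_subspace_of_def\<close>)
qed

end

theorem proposition1p4p9:
  fixes r :: "nat rel" and p :: real
    and J :: "(nat \<Rightarrow> real) \<Rightarrow> 'a::banach" and Y :: "'a set"
  assumes tree: "infinitely_branching_tree r"
    and p: "2 < p"
    and J: "jt_isometry r p J"
    and Y: "closed_subspace_of Y (jt_space J)"
    and no_lp: "\<not> (\<exists>Z. closed_subspace_of Z Y \<and> isomorphic_to_lp p Z)"
  shows "\<exists>(d::nat) (\<tau> :: nat \<Rightarrow> nat set) Y0.
           1 \<le> d \<and> (\<forall>i\<in>{1..d}. is_branch r (\<tau> i)) \<and>
           closed_subspace_of Y0 Y \<and> finite_codim_in Y0 Y \<and>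
           isomorphism_onto_image_on Y0 (jt_restrict J (\<Union>i\<in>{1..d}. \<tau> i))"
proof (rule ccontr)
  assume neg: "\<not> ?thesis"
  interpret jt_completion r p J by unfold_locales (rule tree p J)+
  \<comment> \<open>A spare branch ensures \<open>1 \<le> d\<close> even when \<T> is empty; vectors
    that are flat on the larger union are flat on the smaller one.\<close>
  obtain \<tau>0 where \<tau>0: "is_branch r \<tau>0" using ex_branch by blast
  have "flat_vectors \<theta> (\<lambda>x. \<exists>y\<in>Y. norm (J x - y) < \<eta>) (\<Union>\<T>) N \<noteq> {}"
    if \<T>: "finite \<T>" "\<forall>\<tau>\<in>\<T>. is_branch r \<tau>" and pos: "0 < \<theta>" "0 < \<eta>" for \<T> N \<theta> \<eta>
  proof -
    define d where "d = card (insert \<tau>0 \<T>)"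
    obtain \<tau> where \<tau>: "bij_betw \<tau> {1..d} (insert \<tau>0 \<T>)"
      using ex_bij_betw_nat_finite_1[of "insert \<tau>0 \<T>"] \<T>(1) unfolding d_def by blast
    have d1: "1 \<le> d" using \<T>(1) card_gt_0_iff[of "insert \<tau>0 \<T>"] by (simp add: d_def Suc_le_eq del: card_insert_if)
    have img: "\<tau> ` {1..d} = insert \<tau>0 \<T>" using \<tau> by (simp add: bij_betw_def)
    have "is_branch r (\<tau> i)" if "i \<in> {1..d}" for i
      using imageI[OF that, of \<tau>] \<T>(2) \<tau>0 unfolding img by (elim insertE) simp_all
    \<comment> \<open>The candidate for \<open>Y0\<close> is \<open>kernel_below Y N\<close>. It is
      closed and of finite codimension, so what fails is the isomorphism, and this for every
      \<open>N\<close>.\<close>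
    moreover have "\<not> (1 \<le> d \<and> (\<forall>i\<in>{1..d}. is_branch r (\<tau> i)) \<and>
        closed_subspace_of (kernel_below Y N) Y \<and> finite_codim_in (kernel_below Y N) Y \<and>
        isomorphism_onto_image_on (kernel_below Y N) (jt_restrict J (\<Union>i\<in>{1..d}. \<tau> i)))"
      by (rule neg[unfolded not_ex, THEN spec, THEN spec, THEN spec])
    ultimately have "\<not> isomorphism_onto_image_on (kernel_below Y N) (jt_restrict J (\<Union>i\<in>{1..d}. \<tau> i))"
      using d1 closed_subspace_kernel_below[OF Y, of N] finite_codim_kernel_below[OF Y, of N] by simp
    from flat_vectors_if_not_isomorphism[OF Y this pos]
    have "flat_vectors \<theta> (\<lambda>x. \<exists>y\<in>Y. norm (J x - y) < \<eta>) (\<Union>i\<in>{1..d}. \<tau> i) N \<noteq> {}" .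
    moreover have "flat_vectors \<theta> (\<lambda>x. \<exists>y\<in>Y. norm (J x - y) < \<eta>) (\<Union>i\<in>{1..d}. \<tau> i) N
        \<subseteq> flat_vectors \<theta> (\<lambda>x. \<exists>y\<in>Y. norm (J x - y) < \<eta>) (\<Union>\<T>) N"
      by (rule flat_vectors_antimono) (use img in auto)
    ultimately show ?thesis by auto
  qed
  then have "\<exists>Z. closed_subspace_of Z Y \<and> isomorphic_to_lp p Z"
    using Y by (intro lp_subspace_if_spread_vectors spread_vectors) (auto simp: closed_subspace_of_def)
  then show False using no_lp by blast
qed

end
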